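(* Let $G$ be a CSA$^\ast$-group, let $\phi:A\to B$ be an isomorphism of abelian subgroups of $G$ with $A$ maximal abelian in $G$, and suppose that the HNN-extension $G^\ast=\langle G,t\mid t^{-1}at=\phi(a),\ a\in A\rangle$ is separated. Then $G^\ast$ is a CSA$^\ast$-group.
   Context: A subgroup $H$ of a group $G$ is malnormal if $H\cap x^{-1}Hx=1$ for all $x\in G\setminus H$. A group is a CSA-group if all its maximal abelian subgroups are malnormal. A CSA$^\ast$-group is a CSA-group without elements of order 2. The HNN-extension $G^\ast$ is separated if $A\cap g^{-1}Bg=1$ for all $g\in G$. *)

theory Defs
  imports "HOL-Algebra.Multiplicative_Group"
begin

section \<open>CSA-groups\<close>

definition malnormal :: "'a set \<Rightarrow> ('a, 'b) monoid_scheme \<Rightarrow> bool" where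
  "malnormal H G \<longleftrightarrow>
     subgroup H G \<and>
     (\<forall>x \<in> carrier G - H. H \<inter> ((inv\<^bsub>G\<^esub> x <#\<^bsub>G\<^esub> H) #>\<^bsub>G\<^esub> x) = {\<one>\<^bsub>G\<^esub>})"

text \<open>The name \<open>abelian_subgroup\<close> is already used in the library, for subgroups of additive
  groups of rings.\<close>

definition comm_subgroup :: "'a set \<Rightarrow> ('a, 'b) monoid_scheme \<Rightarrow> bool" where
  "comm_subgroup H G \<longleftrightarrow> subgroup H G \<and> comm_group (G\<lparr>carrier := H\<rparr>)"

definition maximal_comm_subgroup :: "'a set \<Rightarrow> ('a, 'b) monoid_scheme \<Rightarrow> bool" where
  "maximal_comm_subgroup M G \<longleftrightarrow>
     comm_subgroup M G \<and> (\<forall>K. comm_subgroup K G \<and> M \<subseteq> K \<longrightarrow> K = M)"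

definition CSA_group :: "('a, 'b) monoid_scheme \<Rightarrow> bool" where
  "CSA_group G \<longleftrightarrow> group G \<and> (\<forall>M. maximal_comm_subgroup M G \<longrightarrow> malnormal M G)"

definition CSA_star_group :: "('a, 'b) monoid_scheme \<Rightarrow> bool" where
  "CSA_star_group G \<longleftrightarrow> CSA_group G \<and> (\<forall>x \<in> carrier G. group.ord G x \<noteq> 2)"

section \<open>HNN-extensions\<close>

text \<open>The group with presentation \<open>\<langle>G, t | t\<inverse>at = \<phi>(a), a \<in> A\<rangle>\<close> is realised as the monoid of
  words in the elements of \<open>G\<close> and the two letters \<open>t\<close> (\<open>Stable\<close>) and \<open>t\<inverse>\<close> (\<open>StableInv\<close>),
  modulo the least congruence that contains the multiplication table of \<open>G\<close>, the relations
  \<open>tt\<inverse> = t\<inverse>t = 1\<close> and the defining relations. Concatenation of words induces the product.\<close>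

datatype 'a hnn_letter = Base 'a | Stable | StableInv

definition hnn_words :: "('a, 'b) monoid_scheme \<Rightarrow> 'a hnn_letter list set" where
  "hnn_words G = lists (Base ` carrier G \<union> {Stable, StableInv})"

inductive hnn_cong ::
  "('a, 'b) monoid_scheme \<Rightarrow> 'a set \<Rightarrow> ('a \<Rightarrow> 'a)
     \<Rightarrow> 'a hnn_letter list \<Rightarrow> 'a hnn_letter list \<Rightarrow> bool"
  for G A \<phi> where
  base_one: "hnn_cong G A \<phi> [Base \<one>\<^bsub>G\<^esub>] []"
| base_mult: "\<lbrakk>g \<in> carrier G; h \<in> carrier G\<rbrakk>
    \<Longrightarrow> hnn_cong G A \<phi> [Base g, Base h] [Base (g \<otimes>\<^bsub>G\<^esub> h)]"
| stable_right: "hnn_cong G A \<phi> [Stable, StableInv] []"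
| stable_left: "hnn_cong G A \<phi> [StableInv, Stable] []"
| conj: "a \<in> A \<Longrightarrow> hnn_cong G A \<phi> [StableInv, Base a, Stable] [Base (\<phi> a)]"
| refl: "u \<in> hnn_words G \<Longrightarrow> hnn_cong G A \<phi> u u"
| sym: "hnn_cong G A \<phi> u v \<Longrightarrow> hnn_cong G A \<phi> v u"
| trans: "\<lbrakk>hnn_cong G A \<phi> u v; hnn_cong G A \<phi> v w\<rbrakk> \<Longrightarrow> hnn_cong G A \<phi> u w"
| append: "\<lbrakk>hnn_cong G A \<phi> u u'; hnn_cong G A \<phi> v v'\<rbrakk>
    \<Longrightarrow> hnn_cong G A \<phi> (u @ v) (u' @ v')"

definition hnn_rel ::
  "('a, 'b) monoid_scheme \<Rightarrow> 'a set \<Rightarrow> ('a \<Rightarrow> 'a) \<Rightarrow> 'a hnn_letter list rel" where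
  "hnn_rel G A \<phi> = {(u, v). hnn_cong G A \<phi> u v}"

definition hnn_extension ::
  "('a, 'b) monoid_scheme \<Rightarrow> 'a set \<Rightarrow> ('a \<Rightarrow> 'a) \<Rightarrow> 'a hnn_letter list set monoid" where
  "hnn_extension G A \<phi> =
     \<lparr>carrier = hnn_words G // hnn_rel G A \<phi>,
      monoid.mult = (\<lambda>X Y. \<Union>u\<in>X. \<Union>v\<in>Y. hnn_rel G A \<phi> `` {u @ v}),
      one = hnn_rel G A \<phi> `` {[]}\<rparr>"

definition hnn_separated ::
  "('a, 'b) monoid_scheme \<Rightarrow> 'a set \<Rightarrow> 'a set \<Rightarrow> bool" where
  "hnn_separated G A B \<longleftrightarrow>
     (\<forall>g \<in> carrier G. A \<inter> ((inv\<^bsub>G\<^esub> g <#\<^bsub>G\<^esub> B) #>\<^bsub>G\<^esub> g) = {\<one>\<^bsub>G\<^esub>})"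

subsection \<open>The construction is a group with the mapping property of the presentation\<close>

locale hnn_data = group G for G (structure) +
  fixes A :: "'a set" and \<phi> :: "'a \<Rightarrow> 'a"
  assumes A_subset: "A \<subseteq> carrier G" and \<phi>_closed: "a \<in> A \<Longrightarrow> \<phi> a \<in> carrier G"
begin

abbreviation R where "R \<equiv> hnn_rel G A \<phi>"
abbreviation E where "E \<equiv> hnn_extension G A \<phi>"

lemma hnn_words_simps [simp]:
  "[] \<in> hnn_words G"
  "x # w \<in> hnn_words G \<longleftrightarrow> (\<forall>g. x = Base g \<longrightarrow> g \<in> carrier G) \<and> w \<in> hnn_words G"
  "u @ v \<in> hnn_words G \<longleftrightarrow> u \<in> hnn_words G \<and> v \<in> hnn_words G"
  by (cases x; auto simp: hnn_words_def)+

lemma hnn_cong_words: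
  "hnn_cong G A \<phi> u v \<Longrightarrow> u \<in> hnn_words G \<and> v \<in> hnn_words G"
  by (induction rule: hnn_cong.induct) (use A_subset \<phi>_closed in auto)

lemma equiv_hnn_rel: "equiv (hnn_words G) R"
proof (rule equivI)
  show "R \<subseteq> hnn_words G \<times> hnn_words G"
    unfolding hnn_rel_def using hnn_cong_words by blast
  show "refl_on (hnn_words G) R"
    unfolding hnn_rel_def by (rule refl_onI) (simp add: hnn_cong.refl)
  show "sym R"
    unfolding hnn_rel_def by (rule symI) (simp add: hnn_cong.sym)
  show "trans R"
    unfolding hnn_rel_def by (rule transI) (use hnn_cong.trans in blast)
qed

lemma hnn_class_eq_iff:
  assumes "u \<in> hnn_words G" "v \<in> hnn_words G"
  shows "R `` {u} = R `` {v} \<longleftrightarrow> hnn_cong G A \<phi> u v"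
  using eq_equiv_class_iff[OF equiv_hnn_rel assms] by (simp add: hnn_rel_def)

lemma hnn_class_in_carrier: "u \<in> hnn_words G \<Longrightarrow> R `` {u} \<in> carrier E"
  by (simp add: hnn_extension_def quotientI)

lemma hnn_carrierE:
  assumes "X \<in> carrier E"
  obtains u where "u \<in> hnn_words G" "X = R `` {u}"
  using assms by (auto simp: hnn_extension_def elim: quotientE)

lemma hnn_one: "\<one>\<^bsub>E\<^esub> = R `` {[]}"
  by (simp add: hnn_extension_def)

lemma hnn_mult:
  assumes u: "u \<in> hnn_words G" and v: "v \<in> hnn_words G"
  shows "R `` {u} \<otimes>\<^bsub>E\<^esub> R `` {v} = R `` {u @ v}"
proof -
  have eq: "R `` {u' @ v'} = R `` {u @ v}" if "u' \<in> R `` {u}" "v' \<in> R `` {v}" for u' v'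
  proof -
    have "hnn_cong G A \<phi> (u @ v) (u' @ v')"
      using that by (simp add: hnn_rel_def hnn_cong.append)
    then have "hnn_cong G A \<phi> (u' @ v') (u @ v)" by (rule hnn_cong.sym)
    from hnn_cong_words[OF this] this show ?thesis
      by (metis hnn_class_eq_iff)
  qed
  have "u \<in> R `` {u}" "v \<in> R `` {v}"
    using u v by (simp_all add: hnn_rel_def hnn_cong.refl)
  then have "(\<Union>u'\<in>R `` {u}. \<Union>v'\<in>R `` {v}. R `` {u' @ v'}) = R `` {u @ v}"
    using eq by blast
  then show ?thesis
    by (simp add: hnn_extension_def)
qed

fun letter_inv :: "'a hnn_letter \<Rightarrow> 'a hnn_letter" where
  "letter_inv (Base g) = Base (inv g)"
| "letter_inv Stable = StableInv"
| "letter_inv StableInv = Stable"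

lemma letter_inv_cong:
  assumes "[x] \<in> hnn_words G"
  shows "hnn_cong G A \<phi> ([letter_inv x] @ [x]) []"
proof (cases x)
  case (Base g)
  then have g: "g \<in> carrier G" using assms by simp
  have "hnn_cong G A \<phi> [Base (inv g), Base g] [Base \<one>]"
    using hnn_cong.base_mult[of "inv g" G g A \<phi>] g by simp
  from hnn_cong.trans[OF this hnn_cong.base_one] show ?thesis by (simp add: Base)
qed (auto intro: hnn_cong.stable_left hnn_cong.stable_right)

lemma hnn_left_inverse:
  "w \<in> hnn_words G \<Longrightarrow> \<exists>w' \<in> hnn_words G. hnn_cong G A \<phi> (w' @ w) []"
proof (induction w)
  case Nil
  then show ?case by (auto intro!: bexI[of _ "[]"] hnn_cong.refl)
next
  case (Cons x w)
  then obtain w' where w': "w' \<in> hnn_words G" "hnn_cong G A \<phi> (w' @ w) []" by auto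
  have x: "[x] \<in> hnn_words G" and w: "w \<in> hnn_words G" using Cons.prems by auto
  have "hnn_cong G A \<phi> (([letter_inv x] @ [x]) @ w) ([] @ w)"
    by (rule hnn_cong.append[OF letter_inv_cong[OF x] hnn_cong.refl[OF w]])
  from hnn_cong.append[OF hnn_cong.refl[OF w'(1)] this]
  have "hnn_cong G A \<phi> ((w' @ [letter_inv x]) @ x # w) (w' @ w)" by simp
  from hnn_cong.trans[OF this w'(2)]
  have "hnn_cong G A \<phi> ((w' @ [letter_inv x]) @ x # w) []" .
  moreover have "w' @ [letter_inv x] \<in> hnn_words G"
    using x w' by (cases x) auto
  ultimately show ?case by blast
qed

lemma group_hnn_extension: "group E"
proof (rule groupI)
  fix X assume "X \<in> carrier E"
  then obtain w where w: "w \<in> hnn_words G" "X = R `` {w}" by (rule hnn_carrierE)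
  then obtain w' where "w' \<in> hnn_words G" "hnn_cong G A \<phi> (w' @ w) []"
    using hnn_left_inverse by blast
  then have "R `` {w'} \<in> carrier E" "R `` {w'} \<otimes>\<^bsub>E\<^esub> X = \<one>\<^bsub>E\<^esub>"
    using w by (simp_all add: hnn_mult hnn_one hnn_class_eq_iff hnn_class_in_carrier)
  then show "\<exists>Y\<in>carrier E. Y \<otimes>\<^bsub>E\<^esub> X = \<one>\<^bsub>E\<^esub>" by blast
next
  fix X Y assume "X \<in> carrier E" "Y \<in> carrier E"
  then show "X \<otimes>\<^bsub>E\<^esub> Y \<in> carrier E"
    by (elim hnn_carrierE) (simp add: hnn_mult hnn_class_in_carrier)
next
  fix X Y Z assume "X \<in> carrier E" "Y \<in> carrier E" "Z \<in> carrier E"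
  then show "(X \<otimes>\<^bsub>E\<^esub> Y) \<otimes>\<^bsub>E\<^esub> Z = X \<otimes>\<^bsub>E\<^esub> (Y \<otimes>\<^bsub>E\<^esub> Z)"
    by (elim hnn_carrierE) (simp add: hnn_mult)
next
  fix X assume "X \<in> carrier E"
  then show "\<one>\<^bsub>E\<^esub> \<otimes>\<^bsub>E\<^esub> X = X"
    by (elim hnn_carrierE) (simp add: hnn_mult hnn_one)
qed (simp add: hnn_one hnn_class_in_carrier)

lemma hnn_base_hom: "(\<lambda>g. R `` {[Base g]}) \<in> hom G E"
  by (rule homI)
    (simp_all add: hnn_mult hnn_class_in_carrier hnn_class_eq_iff
      hnn_cong.sym[OF hnn_cong.base_mult])

lemma hnn_stable_inv: "inv\<^bsub>E\<^esub> (R `` {[Stable]}) = R `` {[StableInv]}"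
  by (rule group.inv_equality[OF group_hnn_extension])
    (simp_all add: hnn_mult hnn_one hnn_class_in_carrier hnn_class_eq_iff hnn_cong.stable_left)

lemma hnn_relation:
  assumes "a \<in> A"
  shows "inv\<^bsub>E\<^esub> (R `` {[Stable]}) \<otimes>\<^bsub>E\<^esub> R `` {[Base a]} \<otimes>\<^bsub>E\<^esub> R `` {[Stable]} = R `` {[Base (\<phi> a)]}"
proof -
  have "a \<in> carrier G" "\<phi> a \<in> carrier G"
    using assms A_subset \<phi>_closed by auto
  then show ?thesis
    using assms by (simp add: hnn_stable_inv hnn_mult hnn_class_eq_iff hnn_cong.conj)
qed

theorem hnn_universal:
  assumes K: "group K" and f: "f \<in> hom G K" and s: "s \<in> carrier K"
    and rel: "\<And>a. a \<in> A \<Longrightarrow> inv\<^bsub>K\<^esub> s \<otimes>\<^bsub>K\<^esub> f a \<otimes>\<^bsub>K\<^esub> s = f (\<phi> a)"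
  shows "\<exists>h \<in> hom E K. (\<forall>g \<in> carrier G. h (R `` {[Base g]}) = f g) \<and> h (R `` {[Stable]}) = s"
proof -
  interpret K: group K by (rule K)
  note fc = hom_in_carrier[OF f]
  define ev where "ev = (\<lambda>x. case x of Base g \<Rightarrow> f g | Stable \<Rightarrow> s | StableInv \<Rightarrow> inv\<^bsub>K\<^esub> s)"
  define val where "val = (\<lambda>w. foldr (\<lambda>x y. ev x \<otimes>\<^bsub>K\<^esub> y) w \<one>\<^bsub>K\<^esub>)"
  have ev [simp]: "ev (Base g) = f g" "ev Stable = s" "ev StableInv = inv\<^bsub>K\<^esub> s" for g
    by (simp_all add: ev_def)
  have val [simp]: "val [] = \<one>\<^bsub>K\<^esub>" "val (x # w) = ev x \<otimes>\<^bsub>K\<^esub> val w" for x w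
    by (simp_all add: val_def)
  have ev_closed: "ev x \<in> carrier K" if "\<forall>g. x = Base g \<longrightarrow> g \<in> carrier G" for x
    using that by (cases x) (auto simp: s fc)
  have val_closed: "w \<in> hnn_words G \<Longrightarrow> val w \<in> carrier K" for w
    by (induction w) (auto intro: ev_closed)
  have val_append: "u \<in> hnn_words G \<Longrightarrow> v \<in> hnn_words G \<Longrightarrow> val (u @ v) = val u \<otimes>\<^bsub>K\<^esub> val v" for u v
    by (induction u) (auto simp: K.m_assoc ev_closed val_closed)
  have val_cong: "hnn_cong G A \<phi> u v \<Longrightarrow> val u = val v" for u v
  proof (induction rule: hnn_cong.induct)
    case base_one
    then show ?case using hom_one[OF f is_group K] by simp
  next
    case (conj a)
    then have "a \<in> carrier G" "\<phi> a \<in> carrier G" using A_subset \<phi>_closed by auto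
    then show ?case using rel[OF conj] by (simp add: s fc K.m_assoc[symmetric])
  next
    case (append u u' v v')
    then show ?case using hnn_cong_words val_append by metis
  qed (auto simp: s fc hom_mult[OF f] K.m_assoc[symmetric])
  define h where "h = (\<lambda>X. val (SOME w. w \<in> X))"
  have h: "h (R `` {w}) = val w" if "w \<in> hnn_words G" for w
  proof -
    have "w \<in> R `` {w}" using that by (simp add: hnn_rel_def hnn_cong.refl)
    then have "(SOME v. v \<in> R `` {w}) \<in> R `` {w}" by (rule someI)
    then show ?thesis using val_cong unfolding h_def by (fastforce simp: hnn_rel_def)
  qed
  have "h \<in> hom E K"
  proof (rule homI)
    fix X assume "X \<in> carrier E"
    then show "h X \<in> carrier K"
      by (elim hnn_carrierE) (simp add: h val_closed)
  next
    fix X Y assume "X \<in> carrier E" "Y \<in> carrier E"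
    then show "h (X \<otimes>\<^bsub>E\<^esub> Y) = h X \<otimes>\<^bsub>K\<^esub> h Y"
      by (elim hnn_carrierE) (simp add: h hnn_mult val_append)
  qed
  then show ?thesis by (intro bexI[of _ h]) (auto simp: h s fc)
qed

end

end

theory Submission
  imports Defs
begin

text \<open>
  The proof lets the HNN-extension \<open>E\<close> act on its Bass-Serre tree, whose vertices are the cosets
  \<open>X G\<close> and whose edges lead from \<open>X G\<close> to \<open>X t G\<close>. The stabilizer of a vertex is a conjugate of \<open>G\<close>. At
  the vertex \<open>G\<close>, the outgoing edges are stabilized by the conjugates of \<open>A\<close> and the incoming edges
  by the conjugates of \<open>B\<close>. Malnormality of \<open>A\<close> and separation say that a nontrivial element
  can fix two edges at the same vertex only if both are incoming (\<open>fixed_turn_incoming\<close>). Then no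
  nontrivial element fixes a path of length three.

  First, the CSA-property without involutions is expressed by three laws about elements
  (\<open>csa_star_laws\<close>): centralizers of nontrivial elements are abelian, an element that commutes
  with its conjugate by \<open>g\<close> commutes with \<open>g\<close>, and there are no involutions. These laws pass from the
  vertex stabilizers to the whole group, for any action on a tree with the above property of fixed
  edges (\<open>tree_action_laws\<close>). A nontrivial element with a fixed vertex has a canonical one, its
  center, which its centralizer preserves; this reduces the laws to one stabilizer
  (\<open>elliptic_laws\<close>). An element without fixed vertex translates a line (\<open>fixed_or_translates\<close>), and this
  line is unique (\<open>axis_unique\<close>), so the centralizer preserves it and acts on it by
  translations. The action on a line is faithful, so such translations commute. Only a reflection
  of the line could violate the second law, but its square would fix the line, and involutions
  are absent.

  That the coset graph is a tree comes from the normal form theorem for HNN-extensions, in the form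
  of an action of \<open>E\<close> on normal forms (\<open>word_act_cong\<close>). The length of the normal form of \<open>X\<inverse>\<close> gives
  a height function on the cosets \<open>X G\<close> for which every vertex has at most one lower neighbour, and this
  excludes closed reduced paths (\<open>adj_acyclic\<close>).
\<close>

section \<open>CSA-groups without involutions in terms of elements\<close>

text \<open>Maximal abelian subgroups are awkward to follow between a group and the vertex stabilizers of an
  action. These three laws speak about elements only, and relative to a set \<open>S\<close> so that they can be
  stated for a stabilizer inside the whole group. The first
  says that centralizers of nontrivial elements are abelian. In the second, the equation
  \<open>g y = x g\<close> is an inverse-free way to say \<open>y = g\<inverse> x g\<close>: an element that commutes with one of its
  conjugates commutes with the conjugating element.\<close>

definition csa_star_laws :: "('a, 'b) monoid_scheme \<Rightarrow> 'a set \<Rightarrow> bool" where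
  "csa_star_laws G S \<longleftrightarrow>
     (\<forall>x\<in>S - {\<one>\<^bsub>G\<^esub>}. \<forall>y\<in>S. \<forall>z\<in>S.
        x \<otimes>\<^bsub>G\<^esub> y = y \<otimes>\<^bsub>G\<^esub> x \<longrightarrow> x \<otimes>\<^bsub>G\<^esub> z = z \<otimes>\<^bsub>G\<^esub> x \<longrightarrow> y \<otimes>\<^bsub>G\<^esub> z = z \<otimes>\<^bsub>G\<^esub> y) \<and>
     (\<forall>x\<in>S - {\<one>\<^bsub>G\<^esub>}. \<forall>y\<in>S. \<forall>g\<in>S.
        g \<otimes>\<^bsub>G\<^esub> y = x \<otimes>\<^bsub>G\<^esub> g \<longrightarrow> x \<otimes>\<^bsub>G\<^esub> y = y \<otimes>\<^bsub>G\<^esub> x \<longrightarrow> x \<otimes>\<^bsub>G\<^esub> g = g \<otimes>\<^bsub>G\<^esub> x) \<and>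
     (\<forall>x\<in>S. x \<otimes>\<^bsub>G\<^esub> x = \<one>\<^bsub>G\<^esub> \<longrightarrow> x = \<one>\<^bsub>G\<^esub>)"

lemma csa_star_lawsI:
  assumes "\<And>x y z. \<lbrakk>x \<in> S; y \<in> S; z \<in> S; x \<noteq> \<one>\<^bsub>G\<^esub>;
      x \<otimes>\<^bsub>G\<^esub> y = y \<otimes>\<^bsub>G\<^esub> x; x \<otimes>\<^bsub>G\<^esub> z = z \<otimes>\<^bsub>G\<^esub> x\<rbrakk> \<Longrightarrow> y \<otimes>\<^bsub>G\<^esub> z = z \<otimes>\<^bsub>G\<^esub> y"
    and "\<And>x y g. \<lbrakk>x \<in> S; y \<in> S; g \<in> S; x \<noteq> \<one>\<^bsub>G\<^esub>;
      g \<otimes>\<^bsub>G\<^esub> y = x \<otimes>\<^bsub>G\<^esub> g; x \<otimes>\<^bsub>G\<^esub> y = y \<otimes>\<^bsub>G\<^esub> x\<rbrakk> \<Longrightarrow> x \<otimes>\<^bsub>G\<^esub> g = g \<otimes>\<^bsub>G\<^esub> x"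
    and "\<And>x. \<lbrakk>x \<in> S; x \<otimes>\<^bsub>G\<^esub> x = \<one>\<^bsub>G\<^esub>\<rbrakk> \<Longrightarrow> x = \<one>\<^bsub>G\<^esub>"
  shows "csa_star_laws G S"
  using assms unfolding csa_star_laws_def by blast

lemma csa_star_lawsD:
  assumes "csa_star_laws G S"
  shows "\<lbrakk>x \<in> S; y \<in> S; z \<in> S; x \<noteq> \<one>\<^bsub>G\<^esub>;
      x \<otimes>\<^bsub>G\<^esub> y = y \<otimes>\<^bsub>G\<^esub> x; x \<otimes>\<^bsub>G\<^esub> z = z \<otimes>\<^bsub>G\<^esub> x\<rbrakk> \<Longrightarrow> y \<otimes>\<^bsub>G\<^esub> z = z \<otimes>\<^bsub>G\<^esub> y"
    and "\<lbrakk>x \<in> S; y \<in> S; g \<in> S; x \<noteq> \<one>\<^bsub>G\<^esub>;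
      g \<otimes>\<^bsub>G\<^esub> y = x \<otimes>\<^bsub>G\<^esub> g; x \<otimes>\<^bsub>G\<^esub> y = y \<otimes>\<^bsub>G\<^esub> x\<rbrakk> \<Longrightarrow> x \<otimes>\<^bsub>G\<^esub> g = g \<otimes>\<^bsub>G\<^esub> x"
    and "\<lbrakk>x \<in> S; x \<otimes>\<^bsub>G\<^esub> x = \<one>\<^bsub>G\<^esub>\<rbrakk> \<Longrightarrow> x = \<one>\<^bsub>G\<^esub>"
  using assms unfolding csa_star_laws_def by blast+

text \<open>The stabilizer of a vertex of the Bass-Serre tree is an injective image of the base group.\<close>

lemma csa_star_laws_image:
  assumes "group G" "group K" and f: "f \<in> hom G K" and inj: "inj_on f (carrier G)"
    and laws: "csa_star_laws G (carrier G)"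
  shows "csa_star_laws K (f ` carrier G)"
proof -
  interpret G: group G by fact
  have one: "f x = \<one>\<^bsub>K\<^esub> \<longleftrightarrow> x = \<one>\<^bsub>G\<^esub>" if "x \<in> carrier G" for x
    using hom_one[OF f assms(1,2)] inj_onD[OF inj, of x "\<one>\<^bsub>G\<^esub>"] that by auto
  have mult: "f x \<otimes>\<^bsub>K\<^esub> f y = f (x \<otimes>\<^bsub>G\<^esub> y)" if "x \<in> carrier G" "y \<in> carrier G" for x y
    using hom_mult[OF f that] by simp
  have eq: "f x = f y \<longleftrightarrow> x = y" if "x \<in> carrier G" "y \<in> carrier G" for x y
    using inj that by (simp add: inj_on_eq_iff)
  show ?thesis
  proof (rule csa_star_lawsI; elim imageE; hypsubst)
    fix x y z
    assume "x \<in> carrier G" "y \<in> carrier G" "z \<in> carrier G" "f x \<noteq> \<one>\<^bsub>K\<^esub>"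
      "f x \<otimes>\<^bsub>K\<^esub> f y = f y \<otimes>\<^bsub>K\<^esub> f x" "f x \<otimes>\<^bsub>K\<^esub> f z = f z \<otimes>\<^bsub>K\<^esub> f x"
    then show "f y \<otimes>\<^bsub>K\<^esub> f z = f z \<otimes>\<^bsub>K\<^esub> f y"
      using csa_star_lawsD(1)[OF laws, of x y z] by (simp add: one mult eq)
  next
    fix x y g
    assume "x \<in> carrier G" "y \<in> carrier G" "g \<in> carrier G" "f x \<noteq> \<one>\<^bsub>K\<^esub>"
      "f g \<otimes>\<^bsub>K\<^esub> f y = f x \<otimes>\<^bsub>K\<^esub> f g" "f x \<otimes>\<^bsub>K\<^esub> f y = f y \<otimes>\<^bsub>K\<^esub> f x"
    then show "f x \<otimes>\<^bsub>K\<^esub> f g = f g \<otimes>\<^bsub>K\<^esub> f x"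
      using csa_star_lawsD(2)[OF laws, of x y g] by (simp add: one mult eq)
  next
    fix x
    assume "x \<in> carrier G" "f x \<otimes>\<^bsub>K\<^esub> f x = \<one>\<^bsub>K\<^esub>"
    then show "f x = \<one>\<^bsub>K\<^esub>"
      using csa_star_lawsD(3)[OF laws, of x] by (simp add: one mult)
  qed
qed

lemma (in group) commute_inv:
  assumes "x \<otimes> y = y \<otimes> x" "x \<in> carrier G" "y \<in> carrier G"
  shows "x \<otimes> inv y = inv y \<otimes> x"
proof -
  have "inv y \<otimes> x \<otimes> y = x"
    using assms(2,3) by (simp add: m_assoc assms(1)) (simp flip: m_assoc)
  then show ?thesis
    using assms(2,3) by (simp add: inv_solve_right')
qed

lemma (in group) commute_mult:
  assumes "x \<otimes> y = y \<otimes> x" "x \<otimes> z = z \<otimes> x" "x \<in> carrier G" "y \<in> carrier G" "z \<in> carrier G"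
  shows "x \<otimes> (y \<otimes> z) = y \<otimes> z \<otimes> x"
  using assms by (metis m_assoc)

lemma malnormalD:
  assumes "group G" "malnormal H G" "x \<in> carrier G" "h \<in> H" "h \<noteq> \<one>\<^bsub>G\<^esub>" "m \<in> H"
    and eq: "x \<otimes>\<^bsub>G\<^esub> h = m \<otimes>\<^bsub>G\<^esub> x"
  shows "x \<in> H"
proof (rule ccontr)
  assume x: "x \<notin> H"
  interpret group G by fact
  have "subgroup H G" using assms by (simp add: malnormal_def)
  then have [simp]: "m \<in> carrier G" "h \<in> carrier G"
    using assms subgroup.mem_carrier by fast+
  have "h = inv\<^bsub>G\<^esub> x \<otimes>\<^bsub>G\<^esub> m \<otimes>\<^bsub>G\<^esub> x"
    using assms(3) by (simp add: m_assoc flip: eq) (simp flip: m_assoc)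
  then have "h \<in> (inv\<^bsub>G\<^esub> x <#\<^bsub>G\<^esub> H) #>\<^bsub>G\<^esub> x"
    using assms(6) by (auto simp: l_coset_def r_coset_def)
  then show False using assms x by (auto simp: malnormal_def)
qed

lemma comm_subgroup_iff:
  assumes "group G"
  shows "comm_subgroup H G \<longleftrightarrow>
    subgroup H G \<and> (\<forall>x\<in>H. \<forall>y\<in>H. x \<otimes>\<^bsub>G\<^esub> y = y \<otimes>\<^bsub>G\<^esub> x)"
proof
  assume "comm_subgroup H G"
  then have "subgroup H G" "comm_monoid (G\<lparr>carrier := H\<rparr>)"
    by (auto simp: comm_subgroup_def comm_group.axioms(1))
  then show "subgroup H G \<and> (\<forall>x\<in>H. \<forall>y\<in>H. x \<otimes>\<^bsub>G\<^esub> y = y \<otimes>\<^bsub>G\<^esub> x)"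
    using comm_monoid.m_comm[of "G\<lparr>carrier := H\<rparr>"] by simp
next
  assume H: "subgroup H G \<and> (\<forall>x\<in>H. \<forall>y\<in>H. x \<otimes>\<^bsub>G\<^esub> y = y \<otimes>\<^bsub>G\<^esub> x)"
  then have "group (G\<lparr>carrier := H\<rparr>)"
    using group.subgroup_imp_group[OF assms] by blast
  then have "comm_group (G\<lparr>carrier := H\<rparr>)"
    by (rule group.group_comm_groupI) (use H in simp)
  then show "comm_subgroup H G"
    using H by (simp add: comm_subgroup_def)
qed

text \<open>Zorn's lemma is applied to sets of pairwise commuting elements, for which the union of a chain
  is harmless; a maximal one contains everything that commutes with it and is therefore
  automatically a subgroup.\<close>

lemma maximal_comm_subgroup_through:
  assumes "group G" and x: "x \<in> carrier G"
  obtains M where "maximal_comm_subgroup M G" "x \<in> M"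
proof -
  interpret group G by fact
  define comm where "comm = (\<lambda>S. \<forall>y\<in>S. \<forall>z\<in>S. y \<otimes>\<^bsub>G\<^esub> z = z \<otimes>\<^bsub>G\<^esub> y)"
  define F where "F = {S. x \<in> S \<and> S \<subseteq> carrier G \<and> comm S}"
  have FI: "S \<in> F" if "x \<in> S" "S \<subseteq> carrier G" "comm S" for S
    using that by (simp add: F_def)
  have FD: "x \<in> S" "S \<subseteq> carrier G" "comm S" if "S \<in> F" for S
    using that by (simp_all add: F_def)
  have "{x} \<in> F" by (rule FI) (use x in \<open>simp_all add: comm_def\<close>)
  moreover have "\<Union>C \<in> F" if "C \<noteq> {}" and chain: "subset.chain F C" for C
  proof (rule FI)
    have CF: "S \<in> F" if "S \<in> C" for S using chain that by (auto simp: subset_chain_def)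
    show "x \<in> \<Union>C" using CF FD(1) \<open>C \<noteq> {}\<close> by blast
    show "\<Union>C \<subseteq> carrier G" using CF FD(2) by blast
    show "comm (\<Union>C)" unfolding comm_def
    proof (intro ballI)
      fix y z assume "y \<in> \<Union>C" "z \<in> \<Union>C"
      then obtain S T where ST: "S \<in> C" "y \<in> S" "T \<in> C" "z \<in> T" by blast
      then have "S \<subseteq> T \<or> T \<subseteq> S" using chain by (auto simp: subset_chain_def)
      then obtain U where U: "U \<in> C" "y \<in> U" "z \<in> U" using ST by blast
      then show "y \<otimes>\<^bsub>G\<^esub> z = z \<otimes>\<^bsub>G\<^esub> y" using FD(3)[OF CF[OF U(1)]] unfolding comm_def by blast
    qed
  qed
  ultimately obtain M where M: "M \<in> F" and max: "\<forall>S\<in>F. M \<subseteq> S \<longrightarrow> S = M"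
    using subset_Zorn_nonempty[of F] by (metis empty_iff)
  have MG: "y \<in> carrier G" if "y \<in> M" for y using FD(2)[OF M] that by blast
  have commM: "y \<otimes>\<^bsub>G\<^esub> z = z \<otimes>\<^bsub>G\<^esub> y" if "y \<in> M" "z \<in> M" for y z
    using FD(3)[OF M] that unfolding comm_def by blast
  have self: "z \<in> M" if z: "z \<in> carrier G" and zM: "\<And>y. y \<in> M \<Longrightarrow> y \<otimes>\<^bsub>G\<^esub> z = z \<otimes>\<^bsub>G\<^esub> y" for z
  proof -
    have "insert z M \<in> F"
    proof (rule FI)
      show "comm (insert z M)"
        unfolding comm_def using zM zM[symmetric] commM by blast
    qed (use z FD[OF M] in auto)
    then show ?thesis using max by blast
  qed
  have sub: "subgroup M G"
  proof (rule subgroupI)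
    show "M \<subseteq> carrier G" using MG by blast
    show "M \<noteq> {}" using FD(1)[OF M] by blast
    show "inv\<^bsub>G\<^esub> a \<in> M" if "a \<in> M" for a
      by (rule self) (intro inv_closed commute_inv MG commM that; assumption)+
    show "a \<otimes>\<^bsub>G\<^esub> b \<in> M" if "a \<in> M" "b \<in> M" for a b
      by (rule self) (intro m_closed commute_mult MG commM that; assumption)+
  qed
  have "K = M" if K: "comm_subgroup K G" "M \<subseteq> K" for K
  proof -
    have "K \<in> F"
    proof (rule FI)
      show "x \<in> K" using K(2) FD(1)[OF M] by blast
      show "K \<subseteq> carrier G" "comm K"
        using K(1) subgroup.subset unfolding comm_subgroup_iff[OF is_group] comm_def by blast+
    qed
    then show ?thesis using K(2) max by blast
  qed
  moreover have "comm_subgroup M G"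
    unfolding comm_subgroup_iff[OF is_group] using sub commM by blast
  ultimately have "maximal_comm_subgroup M G"
    unfolding maximal_comm_subgroup_def by blast
  then show ?thesis using that FD(1)[OF M] by blast
qed

text \<open>Let \<open>M\<close> be a maximal abelian subgroup through \<open>x \<noteq> 1\<close>. An element that commutes with \<open>x\<close>
  conjugates \<open>x \<in> M\<close> into \<open>M\<close>, so malnormality puts it into \<open>M\<close>. Hence the centralizer of \<open>x\<close> is
  abelian; and if a conjugate of \<open>x\<close> commutes with \<open>x\<close>, then it lies in \<open>M\<close> too, and so does the
  conjugating element.\<close>

lemma CSA_star_group_imp_laws:
  assumes "CSA_star_group G"
  shows "csa_star_laws G (carrier G)"
proof -
  interpret group G using assms by (simp add: CSA_star_group_def CSA_group_def)
  have mal: "malnormal M G" if "maximal_comm_subgroup M G" for M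
    using assms that by (simp add: CSA_star_group_def CSA_group_def)
  have centr: "\<exists>M. maximal_comm_subgroup M G \<and> x \<in> M \<and>
      (\<forall>y\<in>carrier G. x \<otimes>\<^bsub>G\<^esub> y = y \<otimes>\<^bsub>G\<^esub> x \<longrightarrow> y \<in> M) \<and> (\<forall>y\<in>M. \<forall>z\<in>M. y \<otimes>\<^bsub>G\<^esub> z = z \<otimes>\<^bsub>G\<^esub> y)"
    if x: "x \<in> carrier G" "x \<noteq> \<one>\<^bsub>G\<^esub>" for x
  proof -
    obtain M where M: "maximal_comm_subgroup M G" "x \<in> M"
      using maximal_comm_subgroup_through[OF is_group x(1)] .
    have "\<forall>y\<in>M. \<forall>z\<in>M. y \<otimes>\<^bsub>G\<^esub> z = z \<otimes>\<^bsub>G\<^esub> y"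
      using M(1) unfolding maximal_comm_subgroup_def comm_subgroup_iff[OF is_group] by blast
    moreover have "y \<in> M" if "y \<in> carrier G" "x \<otimes>\<^bsub>G\<^esub> y = y \<otimes>\<^bsub>G\<^esub> x" for y
      by (rule malnormalD[OF is_group mal[OF M(1)] that(1) M(2) x(2) M(2)]) (use that in simp)
    ultimately show ?thesis using M by auto
  qed
  show ?thesis
  proof (rule csa_star_lawsI)
    fix x y z
    assume "x \<in> carrier G" "y \<in> carrier G" "z \<in> carrier G" "x \<noteq> \<one>\<^bsub>G\<^esub>"
      "x \<otimes>\<^bsub>G\<^esub> y = y \<otimes>\<^bsub>G\<^esub> x" "x \<otimes>\<^bsub>G\<^esub> z = z \<otimes>\<^bsub>G\<^esub> x"
    moreover from this obtain M where "y \<in> M" "z \<in> M" "\<forall>y\<in>M. \<forall>z\<in>M. y \<otimes>\<^bsub>G\<^esub> z = z \<otimes>\<^bsub>G\<^esub> y"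
      using centr[of x] by auto
    ultimately show "y \<otimes>\<^bsub>G\<^esub> z = z \<otimes>\<^bsub>G\<^esub> y" by simp
  next
    fix x y g
    assume a: "x \<in> carrier G" "y \<in> carrier G" "g \<in> carrier G" "x \<noteq> \<one>\<^bsub>G\<^esub>"
      "g \<otimes>\<^bsub>G\<^esub> y = x \<otimes>\<^bsub>G\<^esub> g" "x \<otimes>\<^bsub>G\<^esub> y = y \<otimes>\<^bsub>G\<^esub> x"
    obtain M where M: "maximal_comm_subgroup M G" "x \<in> M" "y \<in> M" "\<forall>y\<in>M. \<forall>z\<in>M. y \<otimes>\<^bsub>G\<^esub> z = z \<otimes>\<^bsub>G\<^esub> y"
      using centr[OF a(1,4)] a(2,6) by auto
    have "y \<noteq> \<one>\<^bsub>G\<^esub>" using a by auto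
    then have "g \<in> M" using malnormalD[OF is_group mal[OF M(1)] a(3) M(3) _ M(2) a(5)] by simp
    then show "x \<otimes>\<^bsub>G\<^esub> g = g \<otimes>\<^bsub>G\<^esub> x" using M by simp
  next
    fix x assume x: "x \<in> carrier G" "x \<otimes>\<^bsub>G\<^esub> x = \<one>\<^bsub>G\<^esub>"
    then have "x [^]\<^bsub>G\<^esub> (2::nat) = \<one>\<^bsub>G\<^esub>" by (simp add: numeral_2_eq_2)
    then have "ord x dvd 2" using x pow_eq_id by blast
    moreover have "ord x \<noteq> 2" using assms x by (simp add: CSA_star_group_def)
    moreover have "ord x = 0 \<or> ord x = 1 \<or> ord x = 2"
      using dvd_imp_le[OF \<open>ord x dvd 2\<close>] by linarith
    ultimately have "ord x = 1" by auto
    then show "x = \<one>\<^bsub>G\<^esub>" using x ord_eq_1 by blast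
  qed
qed

text \<open>If a nontrivial element \<open>m\<close> of a maximal abelian \<open>M\<close> is conjugated into \<open>M\<close> by \<open>x\<close>, the second
  law makes \<open>x\<close> commute with \<open>m\<close>. By the first law the centralizer of \<open>m\<close> is abelian, so by
  maximality it is \<open>M\<close> itself, and \<open>x \<in> M\<close>.\<close>

lemma laws_imp_CSA_star_group:
  assumes "group G" and laws: "csa_star_laws G (carrier G)"
  shows "CSA_star_group G"
proof -
  interpret group G by fact
  have "malnormal M G" if M: "maximal_comm_subgroup M G" for M
    unfolding malnormal_def
  proof (intro conjI ballI)
    show sub: "subgroup M G" using M by (simp add: maximal_comm_subgroup_def comm_subgroup_def)
    then interpret M: subgroup M G .
    have comm: "\<forall>y\<in>M. \<forall>z\<in>M. y \<otimes>\<^bsub>G\<^esub> z = z \<otimes>\<^bsub>G\<^esub> y"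
      using M unfolding maximal_comm_subgroup_def comm_subgroup_iff[OF is_group] by blast
    fix x assume x: "x \<in> carrier G - M"
    have "inv\<^bsub>G\<^esub> x \<otimes>\<^bsub>G\<^esub> \<one>\<^bsub>G\<^esub> \<otimes>\<^bsub>G\<^esub> x \<in> (inv\<^bsub>G\<^esub> x <#\<^bsub>G\<^esub> M) #>\<^bsub>G\<^esub> x"
      unfolding l_coset_def r_coset_def using M.one_closed by blast
    then have "\<one>\<^bsub>G\<^esub> \<in> (inv\<^bsub>G\<^esub> x <#\<^bsub>G\<^esub> M) #>\<^bsub>G\<^esub> x"
      using x by simp
    moreover have "h = \<one>\<^bsub>G\<^esub>" if h: "h \<in> M" "h \<in> (inv\<^bsub>G\<^esub> x <#\<^bsub>G\<^esub> M) #>\<^bsub>G\<^esub> x" for h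
    proof (rule ccontr)
      assume "h \<noteq> \<one>\<^bsub>G\<^esub>"
      obtain m where m: "m \<in> M" "h = inv\<^bsub>G\<^esub> x \<otimes>\<^bsub>G\<^esub> m \<otimes>\<^bsub>G\<^esub> x"
        using h(2) unfolding l_coset_def r_coset_def by blast
      have [simp]: "m \<in> carrier G" "h \<in> carrier G" "x \<in> carrier G" using m(1) h(1) x by simp_all
      have m1: "m \<noteq> \<one>\<^bsub>G\<^esub>" using m(2) \<open>h \<noteq> \<one>\<^bsub>G\<^esub>\<close> by auto
      have eq: "x \<otimes>\<^bsub>G\<^esub> h = m \<otimes>\<^bsub>G\<^esub> x" unfolding m(2) by (simp flip: m_assoc)
      have mx: "m \<otimes>\<^bsub>G\<^esub> x = x \<otimes>\<^bsub>G\<^esub> m"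
      proof (rule csa_star_lawsD(2)[OF laws, of m h x])
        show "m \<otimes>\<^bsub>G\<^esub> h = h \<otimes>\<^bsub>G\<^esub> m" using comm m(1) h(1) by blast
      qed (simp_all add: m1 eq)
      define C where "C = {z \<in> carrier G. m \<otimes>\<^bsub>G\<^esub> z = z \<otimes>\<^bsub>G\<^esub> m}"
      have "subgroup C G"
      proof (rule subgroupI)
        show "C \<subseteq> carrier G" by (auto simp: C_def)
        show "C \<noteq> {}" by (auto simp: C_def)
        show "inv\<^bsub>G\<^esub> a \<in> C" if "a \<in> C" for a
          using that by (simp add: C_def commute_inv)
        show "a \<otimes>\<^bsub>G\<^esub> b \<in> C" if "a \<in> C" "b \<in> C" for a b
          using that by (simp add: C_def commute_mult)
      qed
      moreover have "y \<otimes>\<^bsub>G\<^esub> z = z \<otimes>\<^bsub>G\<^esub> y" if "y \<in> C" "z \<in> C" for y z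
        using csa_star_lawsD(1)[OF laws, of m y z] m1 that by (simp add: C_def)
      ultimately have "comm_subgroup C G"
        unfolding comm_subgroup_iff[OF is_group] by blast
      moreover have "M \<subseteq> C" using comm m(1) M.subset unfolding C_def by blast
      ultimately have "C = M" using M unfolding maximal_comm_subgroup_def by blast
      moreover have "x \<in> C" using mx by (simp add: C_def)
      ultimately show False using x by simp
    qed
    ultimately show "M \<inter> ((inv\<^bsub>G\<^esub> x <#\<^bsub>G\<^esub> M) #>\<^bsub>G\<^esub> x) = {\<one>\<^bsub>G\<^esub>}"
      using M.one_closed by blast
  qed
  moreover have "ord x \<noteq> 2" if "x \<in> carrier G" for x
  proof
    assume "ord x = 2"
    then have "x [^]\<^bsub>G\<^esub> (2::nat) = \<one>\<^bsub>G\<^esub>" using pow_ord_eq_1[OF that] by simp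
    then have "x \<otimes>\<^bsub>G\<^esub> x = \<one>\<^bsub>G\<^esub>" using that by (simp add: numeral_2_eq_2)
    then have "x = \<one>\<^bsub>G\<^esub>" using csa_star_lawsD(3)[OF laws] that by blast
    then show False using \<open>ord x = 2\<close> by simp
  qed
  ultimately show ?thesis using is_group by (simp add: CSA_star_group_def CSA_group_def)
qed

section \<open>Reduced paths and trees\<close>

fun reduced_path :: "('v \<Rightarrow> 'v \<Rightarrow> bool) \<Rightarrow> 'v list \<Rightarrow> bool" where
  "reduced_path r [] \<longleftrightarrow> False"
| "reduced_path r [v] \<longleftrightarrow> True"
| "reduced_path r (u # v # xs) \<longleftrightarrow> r u v \<and> reduced_path r (v # xs) \<and> (xs \<noteq> [] \<longrightarrow> u \<noteq> hd xs)"

lemma reduced_path_join: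
  "\<lbrakk>reduced_path r (xs @ [v]); reduced_path r (v # ys);
    xs \<noteq> [] \<Longrightarrow> ys \<noteq> [] \<Longrightarrow> last xs \<noteq> hd ys\<rbrakk> \<Longrightarrow> reduced_path r (xs @ v # ys)"
proof (induction xs)
  case (Cons a xs)
  have hd_eq: "hd (zs @ v # ys) = hd (zs @ [v])" for zs by (cases zs) auto
  show ?case using Cons by (cases xs) (auto simp: hd_eq)
qed simp

lemma reduced_path_prefix:
  "\<lbrakk>reduced_path r (xs @ ys); xs \<noteq> []\<rbrakk> \<Longrightarrow> reduced_path r xs"
proof (induction xs)
  case (Cons a xs)
  show ?case
  proof (cases xs)
    case (Cons b zs)
    with Cons.prems Cons.IH show ?thesis by (cases zs) auto
  qed simp
qed simp

lemma reduced_path_suffix: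
  "\<lbrakk>reduced_path r (xs @ ys); ys \<noteq> []\<rbrakk> \<Longrightarrow> reduced_path r ys"
proof (induction xs)
  case (Cons a xs)
  then show ?case by (cases "xs @ ys") auto
qed simp

lemma reduced_path_rev:
  "symp r \<Longrightarrow> reduced_path r xs \<Longrightarrow> reduced_path r (rev xs)"
proof (induction r xs rule: reduced_path.induct)
  case (3 r u v xs)
  then have "r v u" by (auto dest: sympD)
  have "reduced_path r (rev xs @ v # [u])"
    by (rule reduced_path_join) (use 3 \<open>r v u\<close> in \<open>auto simp: last_rev\<close>)
  then show ?case by simp
qed auto

lemma reduced_path_map:
  "\<lbrakk>\<And>u v. r u v \<Longrightarrow> r (f u) (f v); reduced_path r xs; inj_on f (set xs)\<rbrakk>
    \<Longrightarrow> reduced_path r (map f xs)"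
proof (induction r xs rule: reduced_path.induct)
  case (3 r u v xs)
  then have "reduced_path r (map f (v # xs))" by simp
  moreover have "r (f u) (f v)" using 3 by simp
  moreover have "f u \<noteq> f (hd xs)" if "xs \<noteq> []"
    using 3(3,4) that by (metis hd_in_set inj_on_eq_iff list.set_intros reduced_path.simps(3))
  ultimately show ?case by (simp add: hd_map)
qed auto

lemma reduced_path_nth:
  "reduced_path r xs \<Longrightarrow> Suc i < length xs \<Longrightarrow> r (xs ! i) (xs ! Suc i)"
proof (induction r xs arbitrary: i rule: reduced_path.induct)
  case (3 r u v xs)
  then show ?case by (cases i) auto
qed auto

lemma reduced_path_nth2:
  "reduced_path r xs \<Longrightarrow> Suc (Suc i) < length xs \<Longrightarrow> xs ! i \<noteq> xs ! Suc (Suc i)"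
proof (induction r xs arbitrary: i rule: reduced_path.induct)
  case (3 r u v xs)
  then show ?case by (cases i) (auto simp: hd_conv_nth)
qed auto

lemma reduced_path_subset:
  "\<lbrakk>\<And>u v. r u v \<Longrightarrow> v \<in> V; reduced_path r xs; hd xs \<in> V\<rbrakk> \<Longrightarrow> set xs \<subseteq> V"
proof (induction r xs rule: reduced_path.induct)
  case (3 r u v xs)
  from 3(3) have "r u v" by simp
  then have "v \<in> V" by (rule 3(2))
  then show ?case using 3 by simp
qed auto

text \<open>In a graph with a height function in which neighbours differ by one and every vertex has at most
  one lower neighbour, a path that starts at height zero first goes up; having gone up it can only
  come down to where it came from, so without backtracking it climbs forever.\<close>

lemma reduced_path_level:
  assumes r: "symp r"
    and level: "\<And>u v. r u v \<Longrightarrow> lev v = Suc (lev u) \<or> lev u = Suc (lev v)"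
    and parent: "\<And>u v w. \<lbrakk>r u v; r u w; lev v < lev u; lev w < lev u\<rbrakk> \<Longrightarrow> v = w"
    and xs: "reduced_path r xs" "lev (hd xs) = 0"
  shows "i < length xs \<Longrightarrow> lev (xs ! i) = i"
proof (induction i rule: less_induct)
  case (less i)
  show ?case
  proof (cases i)
    case 0
    then show ?thesis using xs less.prems by (simp add: hd_conv_nth)
  next
    case (Suc j)
    have j: "lev (xs ! j) = j" using less Suc by simp
    have rj: "r (xs ! j) (xs ! Suc j)" using reduced_path_nth[OF xs(1)] less.prems Suc by simp
    show ?thesis
    proof (rule ccontr)
      assume "lev (xs ! i) \<noteq> i"
      then have down: "j = Suc (lev (xs ! Suc j))" using level[OF rj] j Suc by simp
      then obtain k where k: "j = Suc k" by blast
      have "r (xs ! j) (xs ! k)"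
        using reduced_path_nth[OF xs(1), of k] sympD[OF r] less.prems Suc k by simp
      moreover have "lev (xs ! k) = k" using less Suc k by simp
      ultimately have "xs ! k = xs ! Suc j" using parent[of "xs ! j" "xs ! k" "xs ! Suc j"] rj down j k by simp
      then show False using reduced_path_nth2[OF xs(1), of k] less.prems Suc k by simp
    qed
  qed
qed

definition undirected :: "('v \<Rightarrow> 'v \<Rightarrow> bool) \<Rightarrow> 'v \<Rightarrow> 'v \<Rightarrow> bool" where
  "undirected r u v \<longleftrightarrow> r u v \<or> r v u"

definition reduced_line :: "('v \<Rightarrow> 'v \<Rightarrow> bool) \<Rightarrow> (int \<Rightarrow> 'v) \<Rightarrow> bool" where
  "reduced_line r L \<longleftrightarrow> (\<forall>n. r (L n) (L (n + 1)) \<and> L n \<noteq> L (n + 2))"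

lemma reduced_line_segment:
  assumes "reduced_line r L"
  shows "a \<le> b \<Longrightarrow> reduced_path r (map L [a..b])"
proof (induction "nat (b - a)" arbitrary: a)
  case 0
  then show ?case by simp
next
  case (Suc n)
  then have IH: "reduced_path r (map L [a+1..b])" by simp
  have ab: "[a..b] = a # [a+1..b]" "[a+1..b] = (a+1) # [a+2..b]"
    using Suc by (simp_all add: upto_rec1 add.commute)
  show ?case
  proof (cases "a + 2 \<le> b")
    case True
    then have "[a+2..b] = (a+2) # [a+3..b]" by (simp add: upto_rec1 add.commute)
    then show ?thesis using IH assms unfolding ab reduced_line_def by simp
  next
    case False
    then show ?thesis using IH assms unfolding ab reduced_line_def by simp
  qed
qed

text \<open>A tree is a connected graph without closed reduced paths. The orientation matters here because
  the two edge inclusions of an HNN-extension play different roles; antisymmetry forbids an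
  automorphism to invert an edge.\<close>

locale oriented_tree =
  fixes V :: "'v set" and arc :: "'v \<Rightarrow> 'v \<Rightarrow> bool"
  assumes V_nonempty: "V \<noteq> {}"
    and arc_vertices: "arc u v \<Longrightarrow> u \<in> V \<and> v \<in> V"
    and arc_asym: "arc u v \<Longrightarrow> \<not> arc v u"
    and connected: "\<lbrakk>u \<in> V; v \<in> V\<rbrakk> \<Longrightarrow> (undirected arc)\<^sup>*\<^sup>* u v"
    and acyclic: "\<lbrakk>reduced_path (undirected arc) xs; 2 \<le> length xs\<rbrakk> \<Longrightarrow> hd xs \<noteq> last xs"
begin

abbreviation adj where "adj \<equiv> undirected arc"
abbreviation path where "path \<equiv> reduced_path adj"

lemma adj_sym: "adj u v \<Longrightarrow> adj v u" by (auto simp: undirected_def)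
lemma symp_adj: "symp adj" by (rule sympI) (rule adj_sym)
lemma adj_vertices: "adj u v \<Longrightarrow> u \<in> V \<and> v \<in> V"
  using arc_vertices by (auto simp: undirected_def)

lemma path_vertices: "path xs \<Longrightarrow> hd xs \<in> V \<Longrightarrow> set xs \<subseteq> V"
  using reduced_path_subset[of adj V] adj_vertices by blast

lemma path_exists:
  assumes "u \<in> V" "v \<in> V"
  obtains xs where "path xs" "hd xs = u" "last xs = v"
proof -
  have "adj\<^sup>*\<^sup>* u v \<Longrightarrow> \<exists>xs. path xs \<and> hd xs = u \<and> last xs = v"
  proof (induction rule: rtranclp_induct)
    case base
    then show ?case by (intro exI[of _ "[u]"]) simp
  next
    case (step v w)
    then obtain xs where xs: "path xs" "hd xs = u" "last xs = v" by blast
    then have ne: "xs \<noteq> []" by auto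
    then have xs': "xs = butlast xs @ [v]" using xs append_butlast_last_id by metis
    \<comment> \<open>Either the new edge undoes the last one, or it can be appended.\<close>
    show ?case
    proof (cases "butlast xs \<noteq> [] \<and> last (butlast xs) = w")
      case True
      then have "path (butlast xs)" using xs' xs(1) reduced_path_prefix by metis
      moreover have "hd (butlast xs) = u" using True xs' xs(2) by (metis hd_append2)
      ultimately show ?thesis using True by blast
    next
      case False
      have "path (butlast xs @ v # [w])"
        by (rule reduced_path_join) (use False xs' xs(1) step(2) in auto)
      then have "path (xs @ [w])" using xs' by (metis append.assoc append_Cons append_Nil)
      then show ?thesis using ne xs(2) by (intro exI[of _ "xs @ [w]"]) simp
    qed
  qed
  then show ?thesis using that connected[OF assms] by blast
qed

text \<open>Where two paths with a common start first diverge, going back along one and on along the other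
  is a reduced path; as the ends agree, it is closed.\<close>

lemma path_unique:
  "\<lbrakk>path xs; path ys; hd xs = hd ys; last xs = last ys\<rbrakk> \<Longrightarrow> xs = ys"
proof (induction xs arbitrary: ys)
  case (Cons a xs)
  obtain zs where ys: "ys = a # zs" using Cons.prems by (cases ys) auto
  show ?case
  proof (cases "xs = [] \<or> zs = []")
    case True
    then show ?thesis
      using Cons.prems ys acyclic[of "a # xs"] acyclic[of "a # zs"]
      by (cases xs; cases zs) (auto split: if_splits)
  next
    case False
    then have ne: "xs \<noteq> []" "zs \<noteq> []" by auto
    have xz: "path xs" "path zs"
      using Cons.prems(1,2) ys ne reduced_path_suffix[of adj "[a]"] by auto
    have "hd xs = hd zs"
    proof (rule ccontr)
      assume neq: "hd xs \<noteq> hd zs"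
      have "path (rev xs @ a # zs)"
      proof (rule reduced_path_join)
        show "path (rev xs @ [a])" using reduced_path_rev[OF symp_adj Cons.prems(1)] by simp
        show "path (a # zs)" using Cons.prems ys by simp
        show "last (rev xs) \<noteq> hd zs" using neq ne by (simp add: last_rev)
      qed
      from acyclic[OF this] show False
        using Cons.prems(4) ys ne by (simp add: hd_rev Suc_le_eq)
    qed
    then have "xs = zs" using Cons.IH[OF xz] Cons.prems(4) ys ne by simp
    then show ?thesis using ys by simp
  qed
qed simp

lemma line_inj:
  assumes L: "reduced_line adj L"
  shows "L a = L b \<longleftrightarrow> a = b"
proof -
  have "L a \<noteq> L b" if "a < b" for a b
    using acyclic[OF reduced_line_segment[OF L, of a b]] that
    by (simp add: hd_map last_map upto_rec1[of a b] upto_rec2[of "a+1" b])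
  then show ?thesis by (metis linorder_neqE)
qed

lemma line_vertices: "reduced_line adj L \<Longrightarrow> L n \<in> V"
  using adj_vertices by (auto simp: reduced_line_def)

lemma line_rev: "reduced_line adj L \<Longrightarrow> reduced_line adj (\<lambda>n. L (- n))"
  unfolding reduced_line_def
proof (intro allI conjI)
  fix n :: int assume L: "\<forall>n. adj (L n) (L (n + 1)) \<and> L n \<noteq> L (n + 2)"
  show "adj (L (- n)) (L (- (n + 1)))" using adj_sym L[rule_format, of "-n-1"] by simp
  show "L (- n) \<noteq> L (- (n + 2))" using L[rule_format, of "-n-2"] by (simp add: eq_commute)
qed

end

section \<open>Group actions on trees\<close>

text \<open>The last two assumptions are what the base group and the separation hypothesis contribute:
  a nontrivial element fixes two edges at a vertex only if both point towards it, and the laws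
  hold in vertex stabilizers.\<close>

locale tree_action = group E + oriented_tree V arc
  for E :: "('e, 'f) monoid_scheme" (structure) and V :: "'v set" and arc +
  fixes act :: "'e \<Rightarrow> 'v \<Rightarrow> 'v" (infixr "\<cdot>" 75)
  assumes act_closed [simp]: "\<lbrakk>x \<in> carrier E; v \<in> V\<rbrakk> \<Longrightarrow> x \<cdot> v \<in> V"
    and act_one [simp]: "v \<in> V \<Longrightarrow> \<one> \<cdot> v = v"
    and act_mult: "\<lbrakk>x \<in> carrier E; y \<in> carrier E; v \<in> V\<rbrakk> \<Longrightarrow> (x \<otimes> y) \<cdot> v = x \<cdot> y \<cdot> v"
    and act_arc: "\<lbrakk>x \<in> carrier E; arc u v\<rbrakk> \<Longrightarrow> arc (x \<cdot> u) (x \<cdot> v)"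
    and fixed_turn_incoming: "\<lbrakk>x \<in> carrier E; arc v u; adj v w; u \<noteq> w;
      x \<cdot> u = u; x \<cdot> v = v; x \<cdot> w = w\<rbrakk> \<Longrightarrow> x = \<one>"
    and stabilizer_laws: "v \<in> V \<Longrightarrow> csa_star_laws E {x \<in> carrier E. x \<cdot> v = v}"
begin

lemma act_inv_act [simp]:
  assumes "x \<in> carrier E" "v \<in> V"
  shows "inv x \<cdot> x \<cdot> v = v" "x \<cdot> inv x \<cdot> v = v"
  using assms by (simp_all flip: act_mult)

lemma act_eq_iff:
  assumes "x \<in> carrier E" "u \<in> V" "v \<in> V"
  shows "x \<cdot> u = x \<cdot> v \<longleftrightarrow> u = v"
  using assms act_inv_act(1) by metis

lemma act_eq_iff_inv:
  assumes "x \<in> carrier E" "u \<in> V" "v \<in> V"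
  shows "inv x \<cdot> u = v \<longleftrightarrow> x \<cdot> v = u"
  using assms act_inv_act by metis

lemma act_adj: "\<lbrakk>x \<in> carrier E; adj u v\<rbrakk> \<Longrightarrow> adj (x \<cdot> u) (x \<cdot> v)"
  using act_arc by (auto simp: undirected_def)

lemma act_path:
  assumes "x \<in> carrier E" "path xs" "hd xs \<in> V"
  shows "path (map ((\<cdot>) x) xs)"
proof (rule reduced_path_map)
  show "inj_on ((\<cdot>) x) (set xs)"
    by (rule inj_onI) (use path_vertices[OF assms(2,3)] assms(1) act_eq_iff in blast)
qed (use assms act_adj in auto)

lemma act_line:
  assumes "x \<in> carrier E" "reduced_line adj L"
  shows "reduced_line adj (\<lambda>n. x \<cdot> L n)"
  using assms act_adj line_vertices[OF assms(2)] by (simp add: reduced_line_def act_eq_iff)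

lemma fixed_ends_fixed_path:
  assumes x: "x \<in> carrier E" and xs: "path xs" "hd xs \<in> V"
    and ends: "x \<cdot> hd xs = hd xs" "x \<cdot> last xs = last xs" and v: "v \<in> set xs"
  shows "x \<cdot> v = v"
proof -
  have ne: "xs \<noteq> []" using xs by auto
  have "map ((\<cdot>) x) xs = xs"
    by (rule path_unique[OF act_path[OF x xs] xs(1)]) (use ne ends in \<open>simp_all add: hd_map last_map\<close>)
  then show ?thesis using v by (metis in_set_conv_nth length_map nth_map)
qed

section \<open>Elements with a fixed vertex\<close>

text \<open>The fixed subtree of a nontrivial element with a fixed vertex is a vertex, an edge, or a star all
  of whose edges point to its middle. A vertex without fixed outgoing edge is the unique vertex in
  the first case, the head in the second and the middle in the third. Being canonical, it is
  respected by centralizers and by conjugation.\<close>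

definition center :: "'e \<Rightarrow> 'v \<Rightarrow> bool" where
  "center x v \<longleftrightarrow> v \<in> V \<and> x \<cdot> v = v \<and> (\<forall>w. arc v w \<longrightarrow> x \<cdot> w \<noteq> w)"

text \<open>One step along a fixed outgoing edge suffices: a further fixed outgoing edge would form a fixed
  turn with an edge that does not point to the turning vertex.\<close>

lemma center_exists:
  assumes x: "x \<in> carrier E" "x \<noteq> \<one>" and v: "v \<in> V" "x \<cdot> v = v"
  obtains w where "center x w"
proof (cases "center x v")
  case False
  then obtain w where w: "arc v w" "x \<cdot> w = w" using v by (auto simp: center_def)
  have "x \<cdot> u \<noteq> u" if "arc w u" for u
    using fixed_turn_incoming[OF x(1) that, of v] w v(2) x(2) arc_asym[OF that] that
    by (auto simp: undirected_def)
  then have "center x w" using w arc_vertices by (auto simp: center_def)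
  then show ?thesis using that by blast
qed (rule that)

text \<open>Everything on the path between two centers is fixed. Its first edge must point to the first
  center, hence leaves the second vertex of the path, where no other edge may be fixed.\<close>

lemma center_unique:
  assumes x: "x \<in> carrier E" "x \<noteq> \<one>" and u: "center x u" and v: "center x v"
  shows "u = v"
proof (rule ccontr)
  assume "u \<noteq> v"
  have uv: "u \<in> V" "v \<in> V" "x \<cdot> u = u" "x \<cdot> v = v" using u v by (auto simp: center_def)
  obtain xs where xs: "path xs" "hd xs = u" "last xs = v" using path_exists[OF uv(1,2)] .
  have fixed: "x \<cdot> w = w" if "w \<in> set xs" for w
    using fixed_ends_fixed_path[OF x(1) xs(1)] xs uv that by simp
  obtain p ys where ys: "xs = u # p # ys"
    using xs \<open>u \<noteq> v\<close> by (metis last.simps list.collapse list.sel(1) reduced_path.simps(1))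
  have "adj u p" using xs(1) ys by simp
  moreover have "\<not> arc u p" using fixed[of p] ys u by (auto simp: center_def)
  ultimately have pu: "arc p u" by (simp add: undirected_def)
  show False
  proof (cases ys)
    case Nil
    then show False using pu v ys xs uv by (auto simp: center_def)
  next
    case (Cons q zs)
    then have "adj p q" "u \<noteq> q" using xs(1) ys by auto
    then show False
      using fixed_turn_incoming[OF x(1) pu, of q] fixed ys Cons uv x(2) by simp
  qed
qed

lemma center_act:
  assumes x: "x \<in> carrier E" and y: "y \<in> carrier E" and g: "g \<in> carrier E"
    and eq: "g \<otimes> y = x \<otimes> g" and v: "center y v"
  shows "center x (g \<cdot> v)"
proof -
  have swap: "x \<cdot> g \<cdot> w = g \<cdot> y \<cdot> w" if "w \<in> V" for w
    using eq x y g that by (simp flip: act_mult)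
  have vV: "v \<in> V" "y \<cdot> v = v" using v by (auto simp: center_def)
  have "x \<cdot> w \<noteq> w" if w: "arc (g \<cdot> v) w" for w
  proof
    assume fx: "x \<cdot> w = w"
    have wV: "w \<in> V" using arc_vertices[OF w] by blast
    have "arc v (inv g \<cdot> w)" using act_arc[OF inv_closed[OF g] w] g vV by simp
    moreover have "y \<cdot> inv g \<cdot> w = inv g \<cdot> w"
      using swap[of "inv g \<cdot> w"] fx g wV y act_eq_iff[OF g, of "y \<cdot> inv g \<cdot> w" "inv g \<cdot> w"] by simp
    ultimately show False using v by (auto simp: center_def)
  qed
  then show ?thesis using swap[OF vV(1)] vV g by (simp add: center_def)
qed

lemma centralizer_fixes_center:
  assumes x: "x \<in> carrier E" "x \<noteq> \<one>" and v: "center x v"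
    and y: "y \<in> carrier E" "x \<otimes> y = y \<otimes> x"
  shows "y \<cdot> v = v"
  using center_unique[OF x center_act[OF x(1) x(1) y(1) y(2)[symmetric] v] v] .

text \<open>The centralizer of \<open>x\<close> fixes the center \<open>v\<close> of \<open>x\<close>, so transitivity of commutation is inherited
  from the stabilizer of \<open>v\<close>. If \<open>y = g\<inverse> x g\<close> commutes with \<open>x\<close>, then \<open>v\<close> is also the center of \<open>y\<close>,
  for \<open>x\<close> permutes the outgoing edges at \<open>v\<close> that \<open>y\<close> fixes, and there is at most one. As \<open>g\<close> carries the
  center of \<open>y\<close> to that of \<open>x\<close>, it fixes \<open>v\<close>, and the second law in the stabilizer applies.\<close>

lemma elliptic_laws:
  assumes x: "x \<in> carrier E" "x \<noteq> \<one>" and v: "center x v"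
  shows elliptic_transitive: "\<lbrakk>y \<in> carrier E; z \<in> carrier E; x \<otimes> y = y \<otimes> x; x \<otimes> z = z \<otimes> x\<rbrakk>
      \<Longrightarrow> y \<otimes> z = z \<otimes> y"
    and elliptic_conjugate: "\<lbrakk>y \<in> carrier E; g \<in> carrier E; g \<otimes> y = x \<otimes> g; x \<otimes> y = y \<otimes> x\<rbrakk>
      \<Longrightarrow> x \<otimes> g = g \<otimes> x"
proof -
  have vV: "v \<in> V" "x \<cdot> v = v" using v by (auto simp: center_def)
  note laws = csa_star_lawsD[OF stabilizer_laws[OF vV(1)]]
  note fix_center = centralizer_fixes_center[OF x v]
  show "y \<otimes> z = z \<otimes> y" if "y \<in> carrier E" "z \<in> carrier E" "x \<otimes> y = y \<otimes> x" "x \<otimes> z = z \<otimes> x"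
    by (rule laws(1)[of x]) (use that x vV fix_center in auto)
  show "x \<otimes> g = g \<otimes> x"
    if y: "y \<in> carrier E" and g: "g \<in> carrier E" and eq: "g \<otimes> y = x \<otimes> g" and comm: "x \<otimes> y = y \<otimes> x"
  proof -
    have y1: "y \<noteq> \<one>"
      using eq x g by auto
    have yv: "y \<cdot> v = v" using fix_center[OF y comm] .
    have "center y v"
      unfolding center_def
    proof (intro conjI allI impI notI vV(1) yv)
      fix w assume w: "arc v w" and yw: "y \<cdot> w = w"
      have wV: "w \<in> V" using arc_vertices[OF w] by blast
      have xw: "arc v (x \<cdot> w)" using act_arc[OF x(1) w] vV by simp
      have "y \<cdot> x \<cdot> w = x \<cdot> w"
        using comm yw x y wV by (metis act_mult)
      then have "x \<cdot> w = w"
        using fixed_turn_incoming[OF y w, of "x \<cdot> w"] xw yw yv y1 by (metis undirected_def)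
      then show False using v w by (auto simp: center_def)
    qed
    then have "g \<cdot> v = v"
      using center_unique[OF x center_act[OF x(1) y g eq] v] by simp
    then show ?thesis
      by (intro laws(2)[of x y g]) (use x y g eq comm vV yv in auto)
  qed
qed

section \<open>Elements without a fixed vertex\<close>

definition translates :: "'e \<Rightarrow> (int \<Rightarrow> 'v) \<Rightarrow> int \<Rightarrow> bool" where
  "translates x L k \<longleftrightarrow> reduced_line adj L \<and> (\<forall>n. x \<cdot> L n = L (n + k))"

lemma translatesD:
  assumes "translates x L k"
  shows "reduced_line adj L" "x \<cdot> L n = L (n + k)" "L n \<in> V" "L a = L b \<longleftrightarrow> a = b"
  using assms line_vertices line_inj by (auto simp: translates_def)

text \<open>Among the first two edges of the line, either both point to the vertex between them or one
  of them leaves it; in the first case the second edge leaves its other end, where the third edge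
  begins.\<close>

lemma fixed_line_trivial:
  assumes x: "x \<in> carrier E" and L: "translates x L 0"
  shows "x = \<one>"
proof -
  note L = translatesD[OF L]
  have fixed: "x \<cdot> L n = L n" for n using L(2)[of n] by simp
  have adj: "adj (L n) (L (n + 1))" for n using L(1) by (simp add: reduced_line_def)
  have turn: "x = \<one>" if "arc (L i) (L j)" "adj (L i) (L k)" "j \<noteq> k" for i j k
    by (rule fixed_turn_incoming[OF x that(1,2)]) (use fixed that(3) L(4) in auto)
  have adj': "adj (L 0) (L 1)" "adj (L 1) (L 2)" "adj (L 2) (L 3)"
    using adj[of 0] adj[of 1] adj[of 2] by simp_all
  then consider "arc (L 1) (L 0)" | "arc (L 1) (L 2)" | "arc (L 2) (L 1)"
    by (auto simp: undirected_def)
  then show ?thesis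
  proof cases
    case 1 then show ?thesis using turn adj'(2) by fastforce
  next
    case 2 then show ?thesis using turn adj_sym[OF adj'(1)] by fastforce
  next
    case 3 then show ?thesis using turn adj'(3) by fastforce
  qed
qed

text \<open>Take a path from \<open>v\<close> to \<open>x \<cdot> v\<close> that is shortest over all \<open>v\<close>. If it has positive length, its
  translates under the powers of \<open>x\<close> fit together to a line: backtracking where two of them meet
  would either yield a shorter path from the second vertex to its image, or, for length
  one, an inverted edge.\<close>

lemma fixed_or_translates:
  assumes x: "x \<in> carrier E"
  obtains v where "v \<in> V" "x \<cdot> v = v" | L k where "translates x L k" "k > 0"
proof -
  define Q where "Q = (\<lambda>xs. path xs \<and> hd xs \<in> V \<and> last xs = x \<cdot> hd xs)"
  obtain v0 where "v0 \<in> V" using V_nonempty by blast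
  then obtain xs0 where "Q xs0" 
    using path_exists[of v0 "x \<cdot> v0"] x unfolding Q_def by (metis act_closed)
  then obtain xs where "Q xs" and min: "\<And>ys. Q ys \<Longrightarrow> length xs \<le> length ys"
    using ex_has_least_nat[of Q xs0 length] by blast
  then have xs: "path xs" "hd xs \<in> V" "last xs = x \<cdot> hd xs" by (auto simp: Q_def)
  then have xV: "set xs \<subseteq> V" using path_vertices by blast
  have "xs \<noteq> []" using xs by auto
  then obtain k where k: "length xs = Suc k" by (cases xs) auto
  define p where "p = (\<lambda>i::int. xs ! nat i)"
  have pV: "p i \<in> V" if "0 \<le> i" "i \<le> int k" for i
    using that xV k unfolding p_def by (auto intro!: nth_mem[THEN subsetD[OF xV]])
  have pk: "p (int k) = x \<cdot> p 0"
    using xs(3) \<open>xs \<noteq> []\<close> k by (simp add: p_def last_conv_nth hd_conv_nth)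
  have padj: "adj (p i) (p (i + 1))" if "0 \<le> i" "i < int k" for i
    using reduced_path_nth[OF xs(1), of "nat i"] that k by (simp add: p_def nat_add_distrib)
  have pneq: "p i \<noteq> p (i + 2)" if "0 \<le> i" "i + 1 < int k" for i
    using reduced_path_nth2[OF xs(1), of "nat i"] that k by (simp add: p_def nat_add_distrib)
  show ?thesis
  proof (cases "k = 0")
    case True
    then show ?thesis using that(1) pk pV by simp
  next
    case False
    then have k0: "int k > 0" by simp
    \<comment> \<open>The vertex number \<open>r\<close> of the path, moved by the \<open>q\<close>-th power, is the vertex number \<open>q k + r\<close> of the line.\<close>
    define L where "L = (\<lambda>n. (x [^] (n div int k)) \<cdot> p (n mod int k))"
    have L: "L (q * int k + r) = (x [^] q) \<cdot> p r" if "0 \<le> r" "r \<le> int k" for q r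
    proof (cases "r = int k")
      case True
      have "q * int k + r = (q + 1) * int k" using True by (simp add: algebra_simps)
      then have "L (q * int k + r) = (x [^] (q + 1)) \<cdot> p 0" using k0 by (simp add: L_def)
      also have "\<dots> = (x [^] q) \<cdot> x \<cdot> p 0"
        using x pV[of 0] by (simp add: int_pow_mult act_mult)
      finally show ?thesis using True pk by simp
    next
      case False
      then have "(q * int k + r) div int k = q" "(q * int k + r) mod int k = r"
        using that k0 by auto
      then show ?thesis by (simp add: L_def)
    qed
    have turn: "p (int k - 1) \<noteq> x \<cdot> p 1"
    proof
      assume eq: "p (int k - 1) = x \<cdot> p 1"
      show False
      proof (cases "k = 1")
        case True
        then have "x \<cdot> p 0 = p 1" "x \<cdot> p 1 = p 0" using eq pk by simp_all
        then show False
          using padj[of 0] True act_arc[OF x, of "p 0" "p 1"] act_arc[OF x, of "p 1" "p 0"] arc_asym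
          by (auto simp: undirected_def)
      next
        case False
        then have k2: "k \<ge> 2" using \<open>k \<noteq> 0\<close> by simp
        then obtain j where j: "k = Suc (Suc j)" by (metis add_2_eq_Suc le_Suc_ex)
        define ys where "ys = butlast (tl xs)"
        have "length ys = k - 1" using k by (simp add: ys_def)
        then have "ys \<noteq> []" using k2 by auto
        have xs_ys: "xs = [hd xs] @ ys @ [last xs]"
          using k k2 \<open>xs \<noteq> []\<close> unfolding ys_def
          by (metis append_Cons append_Nil append_butlast_last_id last_tl length_tl list.collapse
              diff_Suc_1 list.size(3) not_numeral_le_zero)
        have "path ys"
          using reduced_path_prefix[OF reduced_path_suffix[of adj "[hd xs]"]] xs(1) xs_ys \<open>ys \<noteq> []\<close>
          by (metis append_is_Nil_conv)
        moreover have "hd ys = p 1" "last ys = p (int k - 1)"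
          using \<open>ys \<noteq> []\<close> \<open>length ys = k - 1\<close> k j
          by (simp_all add: p_def ys_def hd_conv_nth last_conv_nth nth_butlast nth_tl nat_add_distrib)
        ultimately have "Q ys" using eq pV[of 1] k2 by (simp add: Q_def)
        then show False using min[of ys] \<open>length ys = k - 1\<close> k by simp
      qed
    qed
    have "reduced_line adj L"
      unfolding reduced_line_def
    proof
      fix n
      define q r where "q = n div int k" and "r = n mod int k"
      have n: "n = q * int k + r" by (simp add: q_def r_def)
      have r: "0 \<le> r" "r < int k" using k0 by (simp_all add: r_def)
      have xq: "x [^] q \<in> carrier E" using x by simp
      have Ln: "L n = (x [^] q) \<cdot> p r" using L r n by simp
      have "L (n + 1) = (x [^] q) \<cdot> p (r + 1)" using L[of "r + 1" q] r n by (simp add: algebra_simps)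
      then have "adj (L n) (L (n + 1))" using Ln act_adj[OF xq padj[OF r]] by simp
      moreover have "L n \<noteq> L (n + 2)"
      proof (cases "r + 1 < int k")
        case True
        then have "L (n + 2) = (x [^] q) \<cdot> p (r + 2)" using L[of "r + 2" q] r n by (simp add: algebra_simps)
        then show ?thesis using Ln pneq[OF r(1) True] act_eq_iff[OF xq] pV r True by simp
      next
        case False
        then have r': "r = int k - 1" using r by simp
        have n2: "n + 2 = (q + 1) * int k + 1" using n r' by (simp add: algebra_simps)
        have "L (n + 2) = (x [^] (q + 1)) \<cdot> p 1" unfolding n2 using L[of 1 "q + 1"] k0 by simp
        also have "\<dots> = (x [^] q) \<cdot> x \<cdot> p 1" using x pV[of 1] k0 by (simp add: int_pow_mult act_mult)
        finally show ?thesis using Ln r' turn act_eq_iff[OF xq] pV x k0 by simp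
      qed
      ultimately show "adj (L n) (L (n + 1)) \<and> L n \<noteq> L (n + 2)" ..
    qed
    moreover have "x \<cdot> L n = L (n + int k)" for n
    proof -
      have m: "0 \<le> n mod int k" "n mod int k \<le> int k"
        using k0 by (simp_all add: less_imp_le)
      have "(n + int k) div int k = 1 + n div int k" using k0 by simp
      then have "L (n + int k) = (x [^] (1 + n div int k)) \<cdot> p (n mod int k)" by (simp add: L_def)
      also have "\<dots> = x \<cdot> L n" using x pV[OF m] by (simp only: int_pow_mult) (simp add: act_mult L_def)
      finally show ?thesis by simp
    qed
    ultimately have "translates x L (int k)" by (simp add: translates_def)
    then show ?thesis using that(2) k0 by blast
  qed
qed

text \<open>A vertex \<open>M b\<close> off \<open>L\<close> would be joined to its image by a path that runs to \<open>L\<close>, along \<open>L\<close>, and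
  back by the image of the first part. By uniqueness that is the segment of \<open>M\<close>. But then its
  second vertex is mapped to its last vertex but one, whereas \<open>x\<close> moves \<open>M (b + 1)\<close> to
  \<open>M (b + 1 + k)\<close>.\<close>

lemma axis_subset:
  assumes x: "x \<in> carrier E" and L: "translates x L m" "m > 0" and M: "translates x M k" "k > 0"
  shows "M b \<in> range L"
proof (rule ccontr)
  assume off: "M b \<notin> range L"
  note LD = translatesD[OF L(1)] and MD = translatesD[OF M(1)]
  obtain xs where xs: "path xs" "hd xs = M b" "last xs = L 0"
    using path_exists[OF MD(3) LD(3)] .
  have "xs \<noteq> []" using xs by auto
  then have "\<exists>v\<in>set xs. v \<in> range L" using xs(3) by (metis last_in_set rangeI)
  then obtain ds a es where split: "xs = ds @ L a # es" and ds: "\<forall>v\<in>set ds. v \<notin> range L"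
    using split_list_first_prop[of xs "\<lambda>v. v \<in> range L"] by blast
  have "ds \<noteq> []" using off split xs(2) by (metis append_Nil list.sel(1) rangeI)
  \<comment> \<open>The part of the path up to its first vertex on \<open>L\<close>.\<close>
  define ps where "ps = ds @ [L a]"
  have ps: "path ps" "hd ps = M b"
    using reduced_path_prefix[of adj ps es] xs split \<open>ds \<noteq> []\<close> by (auto simp: ps_def)
  have psV: "set ps \<subseteq> V" using path_vertices[OF ps(1)] ps(2) MD(3) by simp
  define rs where "rs = map ((\<cdot>) x) ds"
  have xps: "map ((\<cdot>) x) ps = rs @ [L (a + m)]" by (simp add: ps_def rs_def LD(2))
  have rs_off: "L n \<noteq> hd (rev rs)" for n
  proof
    assume "L n = hd (rev rs)"
    then have "x \<cdot> L (n - m) = x \<cdot> last ds"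
      using \<open>ds \<noteq> []\<close> LD(2)[of "n - m"] by (simp add: rs_def hd_rev last_map)
    then have "L (n - m) = last ds"
      using act_eq_iff[OF x LD(3)] psV \<open>ds \<noteq> []\<close> by (simp add: ps_def subset_iff)
    then show False using ds \<open>ds \<noteq> []\<close> by (metis last_in_set rangeI)
  qed
  have seg: "[a..a + m] = a # [a + 1..a + m]" "[a..a + m] = [a..a + m - 1] @ [a + m]"
    "[a + 1..a + m] = (a + 1) # [a + 2..a + m]" "[a + 1..a + m] = [a + 1..a + m - 1] @ [a + m]"
    using L(2) upto_rec1[of a "a + m"] upto_rec2[of a "a + m"] upto_rec1[of "a + 1" "a + m"]
      upto_rec2[of "a + 1" "a + m"] by (simp_all add: add.assoc)
  have "path (ds @ L a # map L [a + 1..a + m])"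
  proof (rule reduced_path_join)
    show "path (ds @ [L a])" using ps by (simp add: ps_def)
    show "path (L a # map L [a + 1..a + m])"
      using reduced_line_segment[OF LD(1), of a "a + m"] L(2) seg(1) by simp
    show "last ds \<noteq> hd (map L [a + 1..a + m])"
      using ds \<open>ds \<noteq> []\<close> seg(3) by (metis last_in_set list.sel(1) list.simps(9) rangeI)
  qed
  then have half: "path ((ds @ L a # map L [a + 1..a + m - 1]) @ [L (a + m)])" using seg(4) by simp
  have "path ((ds @ L a # map L [a + 1..a + m - 1]) @ L (a + m) # rev rs)"
  proof (rule reduced_path_join[OF half])
    show "path (L (a + m) # rev rs)"
      using reduced_path_rev[OF symp_adj act_path[OF x ps(1)]] ps(2) MD(3) xps by simp
    show "last (ds @ L a # map L [a + 1..a + m - 1]) \<noteq> hd (rev rs)"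
      using rs_off by (cases "[a + 1..a + m - 1] = []") (simp_all add: last_map)
  qed
  moreover define zs where "zs = ps @ map L [a + 1..a + m] @ rev rs"
  ultimately have "path zs" using seg(4) by (simp add: zs_def ps_def)
  have rev_zs: "rev zs = map ((\<cdot>) x) ps @ rev (map L [a + 1..a + m - 1]) @ rev ps"
    unfolding xps unfolding zs_def seg(4) by simp
  have two: "\<exists>u v us. ps = u # v # us" using \<open>ds \<noteq> []\<close> by (cases ds; cases "tl ds") (auto simp: ps_def)
  then obtain u v us where uv: "ps = u # v # us" by blast
  have seg': "[b..b + k] = b # (b + 1) # [b + 2..b + k]" "[b..b + k] = [b..b + k - 2] @ [b + k - 1, b + k]"
    using M(2) upto_rec1[of b "b + k"] upto_rec1[of "b + 1" "b + k"] 
      upto_rec2[of b "b + k"] upto_rec2[of b "b + k - 1"] by (simp_all add: add.assoc)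
  have "zs = map M [b..b + k]"
  proof (rule path_unique[OF \<open>path zs\<close> reduced_line_segment[OF MD(1)]])
    show "b \<le> b + k" using M(2) by simp
    show "hd zs = hd (map M [b..b + k])" using uv ps(2) by (simp add: zs_def seg'(1))
    have "last zs = hd (rev zs)" by (simp add: hd_rev)
    also have "\<dots> = x \<cdot> M b" unfolding rev_zs using uv ps(2) by simp
    finally show "last zs = last (map M [b..b + k])" using MD(2) by (simp add: seg'(2))
  qed
  then have fwd: "zs = map M [b..b + k]" and bwd: "rev zs = rev (map M [b..b + k])" by simp_all
  have "v = M (b + 1)" using fwd by (simp add: zs_def uv seg'(1))
  moreover have "x \<cdot> v = M (b + k - 1)"
    using bwd unfolding rev_zs seg'(2) by (simp add: uv)
  ultimately have "x \<cdot> M (b + 1) = M (b + k - 1)" by simp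
  then have "M (b + 1 + k) = M (b + k - 1)" using MD(2) by simp
  then show False using MD(4) by simp
qed

text \<open>From a common vertex \<open>p\<close>, both lines follow the unique path to \<open>x \<cdot> p\<close>. Hence the translation
  lengths agree, and so do the lines, first on one period and then everywhere.\<close>

lemma axis_unique:
  assumes x: "x \<in> carrier E" and L: "translates x L m" "m > 0" and M: "translates x M k" "k > 0"
  obtains s where "\<And>n. M n = L (n + s)"
proof -
  note LD = translatesD[OF L(1)] and MD = translatesD[OF M(1)]
  obtain s where s: "M 0 = L s" using axis_subset[OF assms, of 0] by blast
  have "map M [0..k] = map L [s..s + m]"
  proof (rule path_unique[OF reduced_line_segment[OF MD(1)] reduced_line_segment[OF LD(1)]])
    show "hd (map M [0..k]) = hd (map L [s..s + m])"
      using L(2) M(2) s by (simp add: upto_rec1[of 0] upto_rec1[of s])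
    show "last (map M [0..k]) = last (map L [s..s + m])"
      using L(2) M(2) s MD(2)[of 0] LD(2)[of s]
      by (simp add: upto_rec2[of 0 k] upto_rec2[of s "s + m"])
  qed (use L(2) M(2) in auto)
  note eq = this
  then have "length [0..k] = length [s..s + m]" by (metis length_map)
  then have k: "k = m" using L(2) M(2) by simp
  have base: "M i = L (s + i)" if "0 \<le> i" "i \<le> k" for i
  proof -
    have "map M [0..k] ! nat i = map L [s..s + m] ! nat i" using eq by simp
    then show ?thesis using that k by (simp add: nth_upto nat_less_iff)
  qed
  have shift: "M i = L (s + i) \<longleftrightarrow> M (i + k) = L (s + (i + k))" for i
    using act_eq_iff[OF x MD(3) LD(3), of i "s + i"] MD(2)[of i] LD(2)[of "s + i"] k
    by (simp add: add.assoc)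
  have shifts: "M (i + int j * k) = L (s + (i + int j * k)) \<longleftrightarrow> M i = L (s + i)" for i j
  proof (induction j)
    case (Suc j)
    have step: "i + int (Suc j) * k = (i + int j * k) + k" by (simp add: algebra_simps)
    show ?case unfolding step shift[of "i + int j * k", symmetric] by (rule Suc)
  qed simp
  have "M n = L (s + n)" for n
  proof -
    define q r where "q = n div k" and "r = n mod k"
    have n: "n = r + q * k" by (simp add: q_def r_def)
    have "0 \<le> r" "r \<le> k" using M(2) by (simp_all add: r_def less_imp_le)
    then have r: "M r = L (s + r)" by (rule base)
    show ?thesis
    proof (cases "q \<ge> 0")
      case True
      then show ?thesis using shifts[of r "nat q"] r n by simp
    next
      case False
      then have "n + int (nat (- q)) * k = r" using n by (simp add: algebra_simps)
      then show ?thesis using shifts[of n "nat (- q)"] r by simp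
    qed
  qed
  then show ?thesis using that by (simp add: add.commute)
qed

lemma centralizer_translates:
  assumes x: "x \<in> carrier E" and L: "translates x L k" "k > 0"
    and y: "y \<in> carrier E" "x \<otimes> y = y \<otimes> x"
  obtains s where "translates y L s"
proof -
  note LD = translatesD[OF L(1)]
  have "x \<cdot> y \<cdot> L n = y \<cdot> L (n + k)" for n
    using x y LD(2,3) by (metis act_mult)
  then have "translates x (\<lambda>n. y \<cdot> L n) k"
    using act_line[OF y(1) LD(1)] by (simp add: translates_def)
  then obtain s where "\<And>n. y \<cdot> L n = L (n + s)"
    using axis_unique[OF x L] L(2) by blast
  then have "translates y L s" using LD(1) by (simp add: translates_def)
  then show ?thesis by (rule that)
qed

lemma translates_mult:
  assumes "x \<in> carrier E" "y \<in> carrier E" "translates x L a" "translates y L b"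
  shows "translates (x \<otimes> y) L (a + b)"
  using assms translatesD[OF assms(3)] by (simp add: translates_def act_mult algebra_simps)

lemma translates_inv:
  assumes x: "x \<in> carrier E" and L: "translates x L a"
  shows "translates (inv x) L (- a)"
  using act_eq_iff_inv[OF x] translatesD[OF L] by (simp add: translates_def)

text \<open>The commutator of two translations along the same line fixes the line.\<close>

lemma translates_commute:
  assumes x: "x \<in> carrier E" "translates x L a" and y: "y \<in> carrier E" "translates y L b"
  shows "x \<otimes> y = y \<otimes> x"
proof -
  have "translates (x \<otimes> y \<otimes> inv (y \<otimes> x)) L ((a + b) + - (b + a))"
    using x y by (intro translates_mult translates_inv) auto
  then have "x \<otimes> y \<otimes> inv (y \<otimes> x) = \<one>"
    using fixed_line_trivial[of "x \<otimes> y \<otimes> inv (y \<otimes> x)" L] x y by simp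
  then show ?thesis
    using x y by (metis inv_solve_right' l_one m_closed one_closed)
qed

text \<open>An involution cannot move a line along itself without moving it twice as far under its
  square.\<close>

lemma no_involution:
  assumes x: "x \<in> carrier E" "x \<otimes> x = \<one>"
  shows "x = \<one>"
proof (cases rule: fixed_or_translates[OF x(1)])
  case (1 v)
  then show ?thesis using csa_star_lawsD(3)[OF stabilizer_laws[OF 1(1)], of x] x by simp
next
  case (2 L k)
  then have "translates \<one> L (k + k)" using translates_mult[OF x(1) x(1) 2(1) 2(1)] x(2) by simp
  then have "L 0 = L (k + k)" using translatesD(2)[of \<one> L "k + k" 0] translatesD(3)[OF 2(1)] by simp
  then show ?thesis using translatesD(4)[OF 2(1)] 2(2) by simp
qed

text \<open>For \<open>x\<close> with a fixed vertex this is the elliptic case above. Otherwise \<open>x\<close> translates a line \<open>L\<close>, its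
  axis, and so does everything in the centralizer of \<open>x\<close>, which is therefore abelian. If
  \<open>y = g\<inverse> x g\<close> commutes with \<open>x\<close>, then \<open>y\<close> translates both \<open>L\<close> and the image of \<open>L\<close> under \<open>g\<inverse>\<close>, so
  these coincide. Either \<open>g\<close> translates \<open>L\<close> as well, or it reverses \<open>L\<close>; in the second case its
  square fixes \<open>L\<close>, and the absence of involutions gives \<open>g = 1\<close>.\<close>

theorem tree_action_laws: "csa_star_laws E (carrier E)"
proof (rule csa_star_lawsI)
  show "x = \<one>" if "x \<in> carrier E" "x \<otimes> x = \<one>" for x using no_involution[OF that] .
next
  fix x y z
  assume *: "x \<in> carrier E" "y \<in> carrier E" "z \<in> carrier E" "x \<noteq> \<one>"
    "x \<otimes> y = y \<otimes> x" "x \<otimes> z = z \<otimes> x"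
  show "y \<otimes> z = z \<otimes> y"
  proof (cases rule: fixed_or_translates[OF *(1)])
    case (1 v)
    then show ?thesis using center_exists[OF *(1,4)] elliptic_transitive[OF *(1,4)] * by metis
  next
    case (2 L k)
    then show ?thesis using centralizer_translates[OF *(1) 2] translates_commute * by metis
  qed
next
  fix x y g
  assume *: "x \<in> carrier E" "y \<in> carrier E" "g \<in> carrier E" "x \<noteq> \<one>"
    "g \<otimes> y = x \<otimes> g" "x \<otimes> y = y \<otimes> x"
  show "x \<otimes> g = g \<otimes> x"
  proof (cases rule: fixed_or_translates[OF *(1)])
    case (1 v)
    then show ?thesis using center_exists[OF *(1,4)] elliptic_conjugate[OF *(1,4)] * by metis
  next
    case (2 L k)
    note LD = translatesD[OF 2(1)]
    obtain m where m: "translates y L m" using centralizer_translates[OF *(1) 2 *(2,6)] .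
    have "y \<noteq> \<one>" using * by auto
    then have "m \<noteq> 0" using fixed_line_trivial[OF *(2)] m by auto
    have "y \<cdot> inv g \<cdot> L n = inv g \<cdot> L (n + k)" for n
    proof -
      have "y \<otimes> inv g = inv g \<otimes> x"
        using *(1,2,3,5) by (metis inv_closed inv_solve_left inv_solve_right m_assoc m_closed)
      then have "y \<cdot> inv g \<cdot> L n = inv g \<cdot> x \<cdot> L n"
        using *(1,2,3) LD(3) by (metis act_mult inv_closed)
      then show ?thesis using LD(2) by simp
    qed
    then have M: "translates y (\<lambda>n. inv g \<cdot> L n) k"
      using act_line[OF inv_closed[OF *(3)] LD(1)] by (simp add: translates_def)
    show ?thesis
    proof (cases "m > 0")
      case True
      obtain s where "\<And>n. inv g \<cdot> L n = L (n + s)"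
        using axis_unique[OF *(2) m True M 2(2)] by blast
      then have "translates (inv g) L s" using LD(1) by (simp add: translates_def)
      then have "translates g L (- s)" using translates_inv[of "inv g" L s] *(3) by simp
      then show ?thesis using translates_commute[OF *(1) 2(1) *(3)] by simp
    next
      case False
      have rev: "translates y (\<lambda>n. L (- n)) (- m)"
        using line_rev[OF LD(1)] translatesD(2)[OF m] by (simp add: translates_def)
      obtain s where s: "\<And>n. inv g \<cdot> L n = L (- (n + s))"
        using axis_unique[OF *(2) rev _ M 2(2)] False \<open>m \<noteq> 0\<close> by auto
      have "(inv g \<otimes> inv g) \<cdot> L n = L n" for n
        using *(3) s LD(3) by (simp add: act_mult)
      then have "inv g \<otimes> inv g = \<one>"
        using fixed_line_trivial[of "inv g \<otimes> inv g" L] LD(1) *(3) by (simp add: translates_def)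
      then have "inv g = \<one>" using no_involution[of "inv g"] *(3) by simp
      then have "g = \<one>" using *(3) by (metis inv_inv inv_one)
      then show ?thesis using *(1) by simp
    qed
  qed
qed

end

section \<open>Normal forms in HNN-extensions\<close>

locale hnn_iso = hnn_data G A \<phi> for G (structure) and A \<phi> +
  fixes B :: "'a set"
  assumes A_subgroup: "subgroup A G" and B_subgroup: "subgroup B G"
    and \<phi>_iso: "\<phi> \<in> iso (G\<lparr>carrier := A\<rparr>) (G\<lparr>carrier := B\<rparr>)"
begin

text \<open>The sign \<open>s\<close> of a stable letter is \<open>True\<close> for \<open>t\<close> and \<open>False\<close> for \<open>t\<inverse>\<close>. An element \<open>d\<close> of \<open>assoc s\<close>
  can be pulled through from the right of this letter to its left, where it becomes \<open>\<psi> s d\<close>: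
  \<open>t b = \<phi>\<inverse>(b) t\<close> for \<open>b \<in> B\<close> and \<open>t\<inverse> a = \<phi>(a) t\<inverse>\<close> for \<open>a \<in> A\<close>.\<close>

definition assoc :: "bool \<Rightarrow> 'a set" where
  "assoc s = (if s then B else A)"

definition \<psi> :: "bool \<Rightarrow> 'a \<Rightarrow> 'a" where
  "\<psi> s = (if s then inv_into A \<phi> else \<phi>)"

lemma \<phi>_bij: "bij_betw \<phi> A B" and \<phi>_mult: "\<lbrakk>a \<in> A; b \<in> A\<rbrakk> \<Longrightarrow> \<phi> (a \<otimes> b) = \<phi> a \<otimes> \<phi> b"
  using \<phi>_iso by (auto simp: iso_def hom_def)

lemma assoc_subgroup: "subgroup (assoc s) G"
  using A_subgroup B_subgroup by (simp add: assoc_def)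

lemma assoc_closed [simp]: "d \<in> assoc s \<Longrightarrow> d \<in> carrier G"
  using assoc_subgroup subgroup.mem_carrier by fast

lemma assoc_mult [simp]: "\<lbrakk>d \<in> assoc s; e \<in> assoc s\<rbrakk> \<Longrightarrow> d \<otimes> e \<in> assoc s"
  using assoc_subgroup subgroup.m_closed by fast

lemma assoc_inv [simp]: "d \<in> assoc s \<Longrightarrow> inv d \<in> assoc s"
  using assoc_subgroup subgroup.m_inv_closed by fast

lemma assoc_one [simp]: "\<one> \<in> assoc s"
  using assoc_subgroup subgroup.one_closed by fast

lemma assoc_mult_cancel:
  assumes "d \<in> assoc s" "g \<in> carrier G"
  shows "d \<otimes> g \<in> assoc s \<longleftrightarrow> g \<in> assoc s"
proof
  assume "d \<otimes> g \<in> assoc s"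
  then have "inv d \<otimes> (d \<otimes> g) \<in> assoc s" using assms by (meson assoc_mult assoc_inv)
  moreover have "inv d \<otimes> (d \<otimes> g) = g" using assms by (simp flip: m_assoc)
  ultimately show "g \<in> assoc s" by (simp only:)
qed (use assms in simp)

lemma \<psi>_closed [simp]: "d \<in> assoc s \<Longrightarrow> \<psi> s d \<in> assoc (\<not> s)"
  using \<phi>_bij by (cases s) (auto simp: assoc_def \<psi>_def bij_betw_def inv_into_into)

lemma \<psi>_\<psi> [simp]: "d \<in> assoc s \<Longrightarrow> \<psi> (\<not> s) (\<psi> s d) = d"
  using \<phi>_bij by (cases s) (auto simp: assoc_def \<psi>_def bij_betw_def f_inv_into_f inv_into_f_f)

lemma \<psi>_mult:
  assumes "d \<in> assoc s" "e \<in> assoc s"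
  shows "\<psi> s (d \<otimes> e) = \<psi> s d \<otimes> \<psi> s e"
proof (cases s)
  case True
  have "\<psi> s d \<in> A" "\<psi> s e \<in> A" using \<psi>_closed[OF assms(1)] \<psi>_closed[OF assms(2)] True by (auto simp: assoc_def)
  then have "\<phi> (\<psi> s d \<otimes> \<psi> s e) = \<phi> (\<psi> s d) \<otimes> \<phi> (\<psi> s e)" by (rule \<phi>_mult)
  also have "\<dots> = d \<otimes> e" using \<psi>_\<psi>[OF assms(1)] \<psi>_\<psi>[OF assms(2)] True by (simp add: \<psi>_def)
  finally have "inv_into A \<phi> (d \<otimes> e) = inv_into A \<phi> (\<phi> (\<psi> s d \<otimes> \<psi> s e))" by simp
  also have "\<dots> = \<psi> s d \<otimes> \<psi> s e"
    using \<phi>_bij \<open>\<psi> s d \<in> A\<close> \<open>\<psi> s e \<in> A\<close> subgroup.m_closed[OF A_subgroup]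
    by (simp add: bij_betw_def)
  finally show ?thesis using True by (simp add: \<psi>_def)
next
  case False
  then show ?thesis using assms \<phi>_mult by (simp add: assoc_def \<psi>_def)
qed

lemma \<psi>_one [simp]: "\<psi> s \<one> = \<one>"
proof -
  have "\<psi> s \<one> \<otimes> \<psi> s \<one> = \<psi> s \<one>" using \<psi>_mult[of \<one> s \<one>] by simp
  then show ?thesis using \<psi>_closed[OF assoc_one, of s] by (simp add: l_cancel_one')
qed

text \<open>A transversal of the right cosets of \<open>assoc s\<close>, in which the trivial coset is represented by
  \<open>1\<close>.\<close>

definition rep :: "bool \<Rightarrow> 'a \<Rightarrow> 'a" where
  "rep s g = (if g \<in> assoc s then \<one> else SOME h. h \<in> assoc s #> g)"

lemma rep_in_coset:
  assumes g: "g \<in> carrier G"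
  shows "rep s g \<in> assoc s #> g"
proof (cases "g \<in> assoc s")
  case True
  then have "inv g \<otimes> g \<in> assoc s #> g"
    unfolding r_coset_def using assoc_inv by blast
  then show ?thesis using True by (simp add: rep_def)
next
  case False
  have "g \<in> assoc s #> g" by (rule rcos_self[OF g assoc_subgroup])
  then have "(SOME h. h \<in> assoc s #> g) \<in> assoc s #> g" by (rule someI)
  then show ?thesis using False by (simp add: rep_def)
qed

lemma rep_decomp:
  assumes "g \<in> carrier G"
  shows "rep s g \<in> carrier G" "g \<otimes> inv (rep s g) \<in> assoc s" "rep s g \<in> assoc s \<longleftrightarrow> g \<in> assoc s"
proof -
  obtain d where d: "d \<in> assoc s" "rep s g = d \<otimes> g"
    using rep_in_coset[OF assms] by (auto simp: r_coset_def)
  then show "rep s g \<in> carrier G" "rep s g \<in> assoc s \<longleftrightarrow> g \<in> assoc s"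
    using assms assoc_mult_cancel by simp_all
  have "g \<otimes> inv (rep s g) = inv d"
    using d assms by (simp add: inv_mult_group) (simp flip: m_assoc)
  then show "g \<otimes> inv (rep s g) \<in> assoc s" using d by simp
qed

lemma rep_mult:
  assumes "d \<in> assoc s" "g \<in> carrier G"
  shows "rep s (d \<otimes> g) = rep s g"
proof -
  have "assoc s #> (d \<otimes> g) = (assoc s #> d) #> g"
    using assms subgroup.subset[OF assoc_subgroup] by (simp add: coset_mult_assoc)
  also have "assoc s #> d = assoc s"
    using assms assoc_subgroup by (simp add: coset_join2)
  finally show ?thesis using assms by (simp add: rep_def assoc_mult_cancel)
qed

lemma rep_rep: "g \<in> carrier G \<Longrightarrow> rep s (rep s g) = rep s g"
  using rep_in_coset[of g s] rep_mult by (auto simp: r_coset_def)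

text \<open>A pair \<open>(g, [(s\<^sub>1, h\<^sub>1), (s\<^sub>2, h\<^sub>2), \<dots>])\<close> stands for the normal form \<open>g t\<^sup>s\<^sup>1 h\<^sub>1 t\<^sup>s\<^sup>2 h\<^sub>2 \<dots>\<close>, in
  which each \<open>h\<^sub>i\<close> is a coset representative and no \<open>t\<^sup>s 1 t\<^sup>-\<^sup>s\<close> occurs.\<close>

primrec normal :: "(bool \<times> 'a) list \<Rightarrow> bool" where
  "normal [] \<longleftrightarrow> True"
| "normal (x # l) \<longleftrightarrow> snd x \<in> carrier G \<and> rep (fst x) (snd x) = snd x \<and>
     (l \<noteq> [] \<longrightarrow> snd x \<in> assoc (fst x) \<longrightarrow> fst (hd l) = fst x) \<and> normal l"

definition states :: "('a \<times> (bool \<times> 'a) list) set" where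
  "states = {(g, l). g \<in> carrier G \<and> normal l}"

definition pops :: "bool \<Rightarrow> 'a \<times> (bool \<times> 'a) list \<Rightarrow> bool" where
  "pops s \<sigma> \<longleftrightarrow> snd \<sigma> \<noteq> [] \<and> fst (hd (snd \<sigma>)) = (\<not> s) \<and> fst \<sigma> \<in> assoc s"

text \<open>Left multiplication of a normal form by \<open>t\<^sup>s\<close> cancels against its first stable letter, or else
  prefixes a new one. Left multiplication by base elements only changes the first component. The
  normal forms themselves are thus permuted by the letters, and the defining relations hold for these
  permutations, so that the HNN-extension acts.\<close>

definition step :: "bool \<Rightarrow> 'a \<times> (bool \<times> 'a) list \<Rightarrow> 'a \<times> (bool \<times> 'a) list" where
  "step s \<sigma> = (let g = fst \<sigma>; l = snd \<sigma> in
     if pops s \<sigma> then (\<psi> s g \<otimes> snd (hd l), tl l)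
     else (\<psi> s (g \<otimes> inv (rep s g)), (s, rep s g) # l))"

definition shift :: "'a \<Rightarrow> 'a \<times> (bool \<times> 'a) list \<Rightarrow> 'a \<times> (bool \<times> 'a) list" where
  "shift h \<sigma> = (h \<otimes> fst \<sigma>, snd \<sigma>)"

lemma step_states: "\<sigma> \<in> states \<Longrightarrow> step s \<sigma> \<in> states"
proof -
  assume \<sigma>: "\<sigma> \<in> states"
  obtain g l where gl: "\<sigma> = (g, l)" by (cases \<sigma>)
  then have g: "g \<in> carrier G" and l: "normal l" using \<sigma> by (auto simp: states_def)
  show ?thesis
  proof (cases "pops s \<sigma>")
    case True
    then obtain h l' where "l = (\<not> s, h) # l'" "g \<in> assoc s"
      using gl by (cases l) (auto simp: pops_def)
    then show ?thesis using True gl l assoc_closed[OF \<psi>_closed] by (auto simp: step_def states_def Let_def)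
  next
    case False
    then show ?thesis
      using gl g l rep_decomp[OF g] rep_rep[OF g] assoc_closed[OF \<psi>_closed]
      by (auto simp: step_def states_def pops_def Let_def)
  qed
qed

text \<open>A cancellation restores the letter that a prefixing step has inserted. Conversely, a letter
  that a cancellation has removed is prefixed again, for normality excludes that the remainder allows
  another cancellation.\<close>

lemma step_step: "\<sigma> \<in> states \<Longrightarrow> step (\<not> s) (step s \<sigma>) = \<sigma>"
proof -
  assume \<sigma>: "\<sigma> \<in> states"
  obtain g l where gl: "\<sigma> = (g, l)" by (cases \<sigma>)
  then have g: "g \<in> carrier G" and l: "normal l" using \<sigma> by (auto simp: states_def)
  show ?thesis
  proof (cases "pops s \<sigma>")
    case True
    then obtain h l' where l': "l = (\<not> s, h) # l'" and gs: "g \<in> assoc s"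
      using gl by (cases l) (auto simp: pops_def)
    have h: "h \<in> carrier G" "rep (\<not> s) h = h" "l' \<noteq> [] \<Longrightarrow> h \<in> assoc (\<not> s) \<Longrightarrow> fst (hd l') = (\<not> s)"
      using l l' by auto
    have \<psi>g: "\<psi> s g \<in> assoc (\<not> s)" "\<psi> s g \<in> carrier G" using gs assoc_closed[OF \<psi>_closed] by auto
    have step1: "step s \<sigma> = (\<psi> s g \<otimes> h, l')" using True gl l' by (simp add: step_def Let_def)
    have "\<not> pops (\<not> s) (\<psi> s g \<otimes> h, l')"
      using h \<psi>g by (auto simp: pops_def assoc_mult_cancel)
    then show ?thesis
      unfolding step1 using gl l' h \<psi>g gs by (simp add: step_def rep_mult m_assoc)
  next
    case False
    let ?c = "g \<otimes> inv (rep s g)"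
    have step1: "step s \<sigma> = (\<psi> s ?c, (s, rep s g) # l)" using False gl by (simp add: step_def Let_def)
    have "pops (\<not> s) (\<psi> s ?c, (s, rep s g) # l)"
      using rep_decomp[OF g] by (simp add: pops_def)
    then show ?thesis
      unfolding step1 using gl g rep_decomp[OF g] by (simp add: step_def m_assoc)
  qed
qed

lemma step_shift:
  assumes \<sigma>: "\<sigma> \<in> states" and d: "d \<in> assoc s"
  shows "step s (shift d \<sigma>) = shift (\<psi> s d) (step s \<sigma>)"
proof -
  obtain g l where gl: "\<sigma> = (g, l)" by (cases \<sigma>)
  then have g: "g \<in> carrier G" and l: "normal l" using \<sigma> by (auto simp: states_def)
  have \<psi>d: "\<psi> s d \<in> carrier G" using d assoc_closed[OF \<psi>_closed] by blast
  have pops: "pops s (shift d \<sigma>) \<longleftrightarrow> pops s \<sigma>"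
    using d g gl by (simp add: pops_def shift_def assoc_mult_cancel)
  show ?thesis
  proof (cases "pops s \<sigma>")
    case True
    then obtain h l' where l': "l = (\<not> s, h) # l'" and gs: "g \<in> assoc s"
      using gl by (cases l) (auto simp: pops_def)
    moreover have "h \<in> carrier G" using l l' by simp
    moreover have "\<psi> s g \<in> carrier G" using gs assoc_closed[OF \<psi>_closed] by blast
    ultimately show ?thesis
      using True pops gl d \<psi>d by (simp add: step_def shift_def \<psi>_mult m_assoc)
  next
    case False
    have "d \<otimes> g \<otimes> inv (rep s g) = d \<otimes> (g \<otimes> inv (rep s g))"
      using d g rep_decomp(1)[OF g] by (simp add: m_assoc)
    then show ?thesis
      using False pops gl d g rep_decomp[OF g] by (simp add: step_def shift_def \<psi>_mult rep_mult)
  qed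
qed

lemma shift_states: "\<lbrakk>h \<in> carrier G; \<sigma> \<in> states\<rbrakk> \<Longrightarrow> shift h \<sigma> \<in> states"
  by (auto simp: states_def shift_def)

fun letter_act :: "'a hnn_letter \<Rightarrow> 'a \<times> (bool \<times> 'a) list \<Rightarrow> 'a \<times> (bool \<times> 'a) list" where
  "letter_act (Base h) = shift h"
| "letter_act Stable = step True"
| "letter_act StableInv = step False"

abbreviation word_act where "word_act \<equiv> foldr letter_act"

lemma word_act_states: "\<lbrakk>w \<in> hnn_words G; \<sigma> \<in> states\<rbrakk> \<Longrightarrow> word_act w \<sigma> \<in> states"
proof (induction w)
  case (Cons x w)
  then show ?case by (cases x) (auto simp: shift_states step_states)
qed simp

lemma word_act_cong:
  "\<lbrakk>hnn_cong G A \<phi> u v; \<sigma> \<in> states\<rbrakk> \<Longrightarrow> word_act u \<sigma> = word_act v \<sigma>"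
proof (induction arbitrary: \<sigma> rule: hnn_cong.induct)
  case base_one
  then show ?case by (auto simp: shift_def states_def)
next
  case (base_mult g h)
  then show ?case by (auto simp: shift_def states_def m_assoc)
next
  case stable_right
  then show ?case using step_step[of \<sigma> False] by simp
next
  case stable_left
  then show ?case using step_step[of \<sigma> True] by simp
next
  case (conj a)
  then have "step False (shift a (step True \<sigma>)) = shift (\<psi> False a) (step False (step True \<sigma>))"
    by (intro step_shift step_states) (auto simp: assoc_def)
  then show ?case using step_step[OF conj(2), of True] by (simp add: \<psi>_def)
next
  case (append u u' v v')
  then show ?case using word_act_states hnn_cong_words by (metis foldr_append comp_apply)
qed auto

text \<open>The action of a class of words. It does not depend on the chosen word, by \<open>word_act_cong\<close>.\<close>

definition eact :: "'a hnn_letter list set \<Rightarrow> 'a \<times> (bool \<times> 'a) list \<Rightarrow> 'a \<times> (bool \<times> 'a) list" where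
  "eact X = word_act (SOME u. u \<in> X)"

lemma eact_class:
  assumes u: "u \<in> hnn_words G" and \<sigma>: "\<sigma> \<in> states"
  shows "eact (R `` {u}) \<sigma> = word_act u \<sigma>"
proof -
  have "u \<in> R `` {u}" using u by (simp add: hnn_rel_def hnn_cong.refl)
  then have "(SOME v. v \<in> R `` {u}) \<in> R `` {u}" by (rule someI)
  then have "hnn_cong G A \<phi> u (SOME v. v \<in> R `` {u})" by (simp add: hnn_rel_def)
  then show ?thesis using word_act_cong \<sigma> unfolding eact_def by simp
qed

definition base :: "'a \<Rightarrow> 'a hnn_letter list set" where
  "base g = R `` {[Base g]}"

definition \<tau> :: "bool \<Rightarrow> 'a hnn_letter list set" where
  "\<tau> s = R `` {[if s then Stable else StableInv]}"

lemma base_hom: "base \<in> hom G E"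
  unfolding base_def by (rule hnn_base_hom)

lemma \<tau>_closed [simp]: "\<tau> s \<in> carrier E"
  by (simp add: \<tau>_def hnn_class_in_carrier)

lemma base_closed [simp]: "g \<in> carrier G \<Longrightarrow> base g \<in> carrier E"
  by (rule hom_in_carrier[OF base_hom])

lemma base_mult: "\<lbrakk>g \<in> carrier G; h \<in> carrier G\<rbrakk> \<Longrightarrow> base (g \<otimes> h) = base g \<otimes>\<^bsub>E\<^esub> base h"
  by (rule hom_mult[OF base_hom])

lemma base_one: "base \<one> = \<one>\<^bsub>E\<^esub>"
  using hom_one[OF base_hom is_group group_hnn_extension] .

lemma base_inv: "g \<in> carrier G \<Longrightarrow> base (inv g) = inv\<^bsub>E\<^esub> base g"
  using group_hom.hom_inv[of G E base g] base_hom is_group group_hnn_extension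
  by (simp add: group_hom_def group_hom_axioms_def)

lemma \<tau>_inv: "inv\<^bsub>E\<^esub> \<tau> s = \<tau> (\<not> s)"
proof -
  have "inv\<^bsub>E\<^esub> \<tau> True = \<tau> False" using hnn_stable_inv by (simp add: \<tau>_def)
  moreover from this have "inv\<^bsub>E\<^esub> \<tau> False = \<tau> True"
    using group.inv_inv[OF group_hnn_extension \<tau>_closed] by metis
  ultimately show ?thesis by (cases s) auto
qed

lemma base_\<tau>:
  assumes "d \<in> assoc (\<not> s)"
  shows "base d \<otimes>\<^bsub>E\<^esub> \<tau> s = \<tau> s \<otimes>\<^bsub>E\<^esub> base (\<psi> (\<not> s) d)"
proof -
  interpret E: group E by (rule group_hnn_extension)
  have A: "base a \<otimes>\<^bsub>E\<^esub> \<tau> True = \<tau> True \<otimes>\<^bsub>E\<^esub> base (\<phi> a)" if "a \<in> A" for a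
  proof -
    have a: "a \<in> carrier G" "\<phi> a \<in> carrier G" using that A_subset \<phi>_closed by auto
    have "inv\<^bsub>E\<^esub> \<tau> True \<otimes>\<^bsub>E\<^esub> base a \<otimes>\<^bsub>E\<^esub> \<tau> True = base (\<phi> a)"
      using hnn_relation[OF that] by (simp add: base_def \<tau>_def)
    then show ?thesis using a by (simp add: E.m_assoc E.inv_solve_left')
  qed
  show ?thesis
  proof (cases s)
    case True
    then show ?thesis using A assms by (simp add: assoc_def \<psi>_def)
  next
    case False
    define a where "a = \<psi> (\<not> s) d"
    have a: "a \<in> A" "\<phi> a = d" "a \<in> carrier G" "d \<in> carrier G"
      using assms \<psi>_closed[OF assms] \<psi>_\<psi>[OF assms] assoc_closed[OF assms] False A_subset by (auto simp: a_def assoc_def \<psi>_def)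
    have "\<tau> False \<otimes>\<^bsub>E\<^esub> (base a \<otimes>\<^bsub>E\<^esub> \<tau> True) \<otimes>\<^bsub>E\<^esub> \<tau> False = \<tau> False \<otimes>\<^bsub>E\<^esub> (\<tau> True \<otimes>\<^bsub>E\<^esub> base d) \<otimes>\<^bsub>E\<^esub> \<tau> False"
      using A[OF a(1)] a(2) by simp
    moreover have "\<tau> False \<otimes>\<^bsub>E\<^esub> \<tau> True = \<one>\<^bsub>E\<^esub>" "\<tau> True \<otimes>\<^bsub>E\<^esub> \<tau> False = \<one>\<^bsub>E\<^esub>"
      using \<tau>_inv[of True] E.l_inv[OF \<tau>_closed, of True] E.r_inv[OF \<tau>_closed, of True] by simp_all
    ultimately have "\<tau> False \<otimes>\<^bsub>E\<^esub> base a = base d \<otimes>\<^bsub>E\<^esub> \<tau> False"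
      using a by (metis E.l_one E.r_one E.m_assoc E.m_closed \<tau>_closed base_closed)
    then show ?thesis using False a_def by simp
  qed
qed

lemma hnn_induct [consumes 1, case_names one base stable]:
  assumes X: "X \<in> carrier E" and one: "P \<one>\<^bsub>E\<^esub>"
    and base: "\<And>g X. \<lbrakk>g \<in> carrier G; X \<in> carrier E; P X\<rbrakk> \<Longrightarrow> P (base g \<otimes>\<^bsub>E\<^esub> X)"
    and stable: "\<And>s X. \<lbrakk>X \<in> carrier E; P X\<rbrakk> \<Longrightarrow> P (\<tau> s \<otimes>\<^bsub>E\<^esub> X)"
  shows "P X"
proof -
  obtain w where w: "w \<in> hnn_words G" "X = R `` {w}" using X by (rule hnn_carrierE)
  have "w \<in> hnn_words G \<Longrightarrow> P (R `` {w})" for w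
  proof (induction w)
    case Nil
    show ?case using one unfolding hnn_one .
  next
    case (Cons x w)
    then have w: "R `` {w} \<in> carrier E" "P (R `` {w})" by (simp_all add: hnn_class_in_carrier)
    have split: "R `` {x # w} = R `` {[x]} \<otimes>\<^bsub>E\<^esub> R `` {w}" using Cons.prems by (simp add: hnn_mult)
    show ?case
    proof (cases x)
      case (Base g)
      then have "g \<in> carrier G" using Cons.prems by simp
      then have "P (base g \<otimes>\<^bsub>E\<^esub> R `` {w})" using w by (rule base)
      then show ?thesis unfolding split unfolding Base base_def .
    next
      case Stable
      have "P (\<tau> True \<otimes>\<^bsub>E\<^esub> R `` {w})" using w by (rule stable)
      then show ?thesis unfolding split unfolding Stable \<tau>_def if_True .
    next
      case StableInv
      have "P (\<tau> False \<otimes>\<^bsub>E\<^esub> R `` {w})" using w by (rule stable)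
      then show ?thesis unfolding split unfolding StableInv \<tau>_def if_False .
    qed
  qed
  then show ?thesis unfolding w(2) using w(1) by blast
qed

lemma eact_states: "\<lbrakk>X \<in> carrier E; \<sigma> \<in> states\<rbrakk> \<Longrightarrow> eact X \<sigma> \<in> states"
  by (elim hnn_carrierE) (simp add: eact_class word_act_states)

lemma eact_mult: "\<lbrakk>X \<in> carrier E; Y \<in> carrier E; \<sigma> \<in> states\<rbrakk> \<Longrightarrow> eact (X \<otimes>\<^bsub>E\<^esub> Y) \<sigma> = eact X (eact Y \<sigma>)"
  by (elim hnn_carrierE) (simp add: hnn_mult eact_class word_act_states)

lemma eact_one: "\<sigma> \<in> states \<Longrightarrow> eact \<one>\<^bsub>E\<^esub> \<sigma> = \<sigma>"
  by (simp add: hnn_one eact_class)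

lemma eact_base: "\<lbrakk>g \<in> carrier G; \<sigma> \<in> states\<rbrakk> \<Longrightarrow> eact (base g) \<sigma> = shift g \<sigma>"
  by (simp add: base_def eact_class)

lemma eact_\<tau>: "\<sigma> \<in> states \<Longrightarrow> eact (\<tau> s) \<sigma> = step s \<sigma>"
  by (simp add: \<tau>_def eact_class)

end

section \<open>The Bass-Serre tree of a separated HNN-extension\<close>

locale separated_hnn = hnn_iso G A \<phi> B for G (structure) and A \<phi> B +
  assumes A_malnormal: "malnormal A G" and separated: "hnn_separated G A B"
    and G_laws: "csa_star_laws G (carrier G)"
begin

interpretation E: group E by (rule group_hnn_extension)

text \<open>The Bass-Serre tree: its vertices are the left cosets of the base group, and an edge leads from
  \<open>X H\<close> to \<open>X t H\<close>.\<close>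

definition H :: "'a hnn_letter list set set" where "H = base ` carrier G"

lemma H_subgroup: "subgroup H E"
  unfolding H_def
  using group_hom.img_is_subgroup[of G E base] base_hom is_group E.is_group
  by (simp add: group_hom_def group_hom_axioms_def)

definition coset :: "'a hnn_letter list set \<Rightarrow> 'a hnn_letter list set set" where
  "coset X = X <#\<^bsub>E\<^esub> H"

definition vertices :: "'a hnn_letter list set set set" where
  "vertices = coset ` carrier E"

definition arc :: "'a hnn_letter list set set \<Rightarrow> 'a hnn_letter list set set \<Rightarrow> bool" where
  "arc u v \<longleftrightarrow> (\<exists>X\<in>carrier E. u = coset X \<and> v = coset (X \<otimes>\<^bsub>E\<^esub> \<tau> True))"

abbreviation adj where "adj \<equiv> undirected arc"

abbreviation act where "act X u \<equiv> X <#\<^bsub>E\<^esub> u"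

lemma base_in_H: "g \<in> carrier G \<Longrightarrow> base g \<in> H"
  by (simp add: H_def)

lemma act_coset: "\<lbrakk>X \<in> carrier E; Y \<in> carrier E\<rbrakk> \<Longrightarrow> act X (coset Y) = coset (X \<otimes>\<^bsub>E\<^esub> Y)"
  unfolding coset_def using E.lcos_m_assoc subgroup.subset[OF H_subgroup] by blast

lemma coset_base:
  assumes "X \<in> carrier E" "g \<in> carrier G"
  shows "coset (X \<otimes>\<^bsub>E\<^esub> base g) = coset X"
proof -
  have "coset (X \<otimes>\<^bsub>E\<^esub> base g) = act X (coset (base g))" using assms by (simp add: act_coset)
  also have "coset (base g) = H"
    unfolding coset_def using E.coset_join3[OF _ H_subgroup] assms base_in_H by simp
  finally show ?thesis by (simp add: coset_def)
qed

lemma coset_eqE: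
  assumes "X \<in> carrier E" "Y \<in> carrier E" "coset X = coset Y"
  obtains g where "g \<in> carrier G" "Y = X \<otimes>\<^bsub>E\<^esub> base g"
proof -
  have "Y \<otimes>\<^bsub>E\<^esub> \<one>\<^bsub>E\<^esub> \<in> coset Y"
    unfolding coset_def l_coset_def using subgroup.one_closed[OF H_subgroup] by blast
  then have "Y \<in> coset X" using assms by simp
  then show ?thesis using that unfolding coset_def l_coset_def H_def by blast
qed

lemma coset_in_vertices: "X \<in> carrier E \<Longrightarrow> coset X \<in> vertices"
  by (simp add: vertices_def)

lemma act_vertices: "\<lbrakk>X \<in> carrier E; u \<in> vertices\<rbrakk> \<Longrightarrow> act X u \<in> vertices"
  by (auto simp: vertices_def act_coset)

lemma act_one: "u \<in> vertices \<Longrightarrow> act \<one>\<^bsub>E\<^esub> u = u"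
  by (auto simp: vertices_def act_coset)

lemma act_mult:
  "\<lbrakk>X \<in> carrier E; Y \<in> carrier E; u \<in> vertices\<rbrakk> \<Longrightarrow> act (X \<otimes>\<^bsub>E\<^esub> Y) u = act X (act Y u)"
  by (auto simp: vertices_def act_coset E.m_assoc)

lemma act_arc: "\<lbrakk>X \<in> carrier E; arc u v\<rbrakk> \<Longrightarrow> arc (act X u) (act X v)"
  unfolding arc_def by (metis E.m_assoc E.m_closed \<tau>_closed act_coset)

lemma act_adj: "\<lbrakk>X \<in> carrier E; adj u v\<rbrakk> \<Longrightarrow> adj (act X u) (act X v)"
  using act_arc by (auto simp: undirected_def)

lemma arc_vertices: "arc u v \<Longrightarrow> u \<in> vertices \<and> v \<in> vertices"
  by (auto simp: arc_def vertices_def)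

lemma adj_vertices: "adj u v \<Longrightarrow> u \<in> vertices \<and> v \<in> vertices"
  using arc_vertices by (auto simp: undirected_def)

lemma \<tau>_\<tau>: "\<tau> s \<otimes>\<^bsub>E\<^esub> \<tau> (\<not> s) = \<one>\<^bsub>E\<^esub>"
  using E.r_inv[OF \<tau>_closed, of s] \<tau>_inv by simp

lemma adj_coset: "X \<in> carrier E \<Longrightarrow> adj (coset X) (coset (X \<otimes>\<^bsub>E\<^esub> \<tau> s))"
proof (cases s)
  case False
  assume X: "X \<in> carrier E"
  have "X \<otimes>\<^bsub>E\<^esub> \<tau> False \<otimes>\<^bsub>E\<^esub> \<tau> True = X" using \<tau>_\<tau>[of False] X by (simp add: E.m_assoc)
  then have "arc (coset (X \<otimes>\<^bsub>E\<^esub> \<tau> False)) (coset X)"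
    unfolding arc_def using X by (intro bexI[of _ "X \<otimes>\<^bsub>E\<^esub> \<tau> False"]) auto
  then show ?thesis using False by (simp add: undirected_def)
qed (auto simp: undirected_def arc_def)

lemma adjE:
  assumes "adj u v"
  obtains X s where "X \<in> carrier E" "u = coset X" "v = coset (X \<otimes>\<^bsub>E\<^esub> \<tau> s)"
proof (cases "arc u v")
  case True
  then show ?thesis using that unfolding arc_def by blast
next
  case False
  then obtain X where X: "X \<in> carrier E" "v = coset X" "u = coset (X \<otimes>\<^bsub>E\<^esub> \<tau> True)"
    using assms by (auto simp: undirected_def arc_def)
  have "X \<otimes>\<^bsub>E\<^esub> \<tau> True \<otimes>\<^bsub>E\<^esub> \<tau> False = X" using \<tau>_\<tau>[of True] X by (simp add: E.m_assoc)
  then show ?thesis using that[of "X \<otimes>\<^bsub>E\<^esub> \<tau> True" False] X by simp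
qed

lemma origin_state: "(\<one>, []) \<in> states" by (simp add: states_def)

text \<open>The inverse makes the second component invariant under right multiplication of \<open>X\<close> by the base
  group, so that its length is a function of the coset \<open>X H\<close>: the distance of that vertex from \<open>H\<close>.\<close>

definition state :: "'a hnn_letter list set \<Rightarrow> 'a \<times> (bool \<times> 'a) list" where
  "state X = eact (inv\<^bsub>E\<^esub> X) (\<one>, [])"

lemma state_closed: "X \<in> carrier E \<Longrightarrow> state X \<in> states"
  by (simp add: state_def eact_states origin_state)

lemma state_base: "\<lbrakk>X \<in> carrier E; g \<in> carrier G\<rbrakk> \<Longrightarrow> state (X \<otimes>\<^bsub>E\<^esub> base g) = shift (inv g) (state X)"
  using state_closed
  by (simp add: state_def E.inv_mult_group eact_mult origin_state base_inv[symmetric] eact_base)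

lemma state_\<tau>: "X \<in> carrier E \<Longrightarrow> state (X \<otimes>\<^bsub>E\<^esub> \<tau> s) = step (\<not> s) (state X)"
  using state_closed
  by (simp add: state_def E.inv_mult_group eact_mult origin_state \<tau>_inv eact_\<tau>)

lemma state_one: "state \<one>\<^bsub>E\<^esub> = (\<one>, [])"
  by (simp add: state_def eact_one origin_state)

lemma length_step:
  "length (snd (step s \<sigma>)) = (if pops s \<sigma> then length (snd \<sigma>) - 1 else Suc (length (snd \<sigma>)))"
  by (simp add: step_def Let_def)

definition lev :: "'a hnn_letter list set set \<Rightarrow> nat" where
  "lev u = length (snd (state (SOME X. X \<in> carrier E \<and> coset X = u)))"

lemma lev_coset:
  assumes X: "X \<in> carrier E"
  shows "lev (coset X) = length (snd (state X))"
proof -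
  define Y where "Y = (SOME Y. Y \<in> carrier E \<and> coset Y = coset X)"
  have Y: "Y \<in> carrier E \<and> coset Y = coset X"
    unfolding Y_def by (rule someI[of _ X]) (use X in simp)
  then obtain g where "g \<in> carrier G" "Y = X \<otimes>\<^bsub>E\<^esub> base g"
    using coset_eqE[OF X, of Y] by metis
  then show ?thesis using state_base[OF X] unfolding lev_def Y_def[symmetric] by (simp add: shift_def)
qed

lemma lev_adj:
  assumes "adj u v"
  shows "lev v = Suc (lev u) \<or> lev u = Suc (lev v)"
proof -
  obtain X s where X: "X \<in> carrier E" "u = coset X" "v = coset (X \<otimes>\<^bsub>E\<^esub> \<tau> s)"
    using adjE[OF assms] .
  have "snd (state X) \<noteq> []" if "pops (\<not> s) (state X)" using that by (simp add: pops_def)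
  then show ?thesis using X by (auto simp: lev_coset state_\<tau> length_step)
qed

text \<open>The sign of the edge to a lower neighbour is dictated by the first letter of the normal form.
  Two such edges differ by an element \<open>g\<close> of the associated subgroup, which can be pulled through
  the stable letter into \<open>H\<close>.\<close>

lemma parent_unique:
  assumes v: "adj u v" "lev v < lev u" and w: "adj u w" "lev w < lev u"
  shows "v = w"
proof -
  obtain X s where X: "X \<in> carrier E" "u = coset X" "v = coset (X \<otimes>\<^bsub>E\<^esub> \<tau> s)"
    using adjE[OF v(1)] .
  obtain Y s' where Y: "Y \<in> carrier E" "u = coset Y" "w = coset (Y \<otimes>\<^bsub>E\<^esub> \<tau> s')"
    using adjE[OF w(1)] .
  obtain g where g: "g \<in> carrier G" "Y = X \<otimes>\<^bsub>E\<^esub> base g"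
    using coset_eqE[of X Y] X Y by metis
  have "pops (\<not> s) (state X)" using v(2) X by (simp add: lev_coset state_\<tau> length_step split: if_splits)
  moreover have "pops (\<not> s') (state Y)" using w(2) Y by (simp add: lev_coset state_\<tau> length_step split: if_splits)
  ultimately have s': "s' = s" and d: "fst (state X) \<in> assoc (\<not> s)" "inv g \<otimes> fst (state X) \<in> assoc (\<not> s)"
    using state_base[OF X(1) g(1)] g by (auto simp: pops_def shift_def)
  have "inv g = (inv g \<otimes> fst (state X)) \<otimes> inv (fst (state X))"
    using d(1) g by (simp add: m_assoc)
  then have "inv g \<in> assoc (\<not> s)" using d assoc_mult[OF d(2) assoc_inv[OF d(1)]] by simp
  then have gs: "g \<in> assoc (\<not> s)" using assoc_inv[of "inv g"] g by fastforce
  have "w = coset (X \<otimes>\<^bsub>E\<^esub> (base g \<otimes>\<^bsub>E\<^esub> \<tau> s))" using Y g X s' by (simp add: E.m_assoc)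
  also have "\<dots> = coset ((X \<otimes>\<^bsub>E\<^esub> \<tau> s) \<otimes>\<^bsub>E\<^esub> base (\<psi> (\<not> s) g))"
    using base_\<tau>[OF gs] X assoc_closed[OF \<psi>_closed[OF gs]] by (simp add: E.m_assoc)
  also have "\<dots> = v" using X assoc_closed[OF \<psi>_closed[OF gs]] by (simp add: coset_base)
  finally show ?thesis by simp
qed

lemma symp_adj: "symp adj"
  by (rule sympI) (auto simp: undirected_def)

text \<open>After a translation the path starts at \<open>H\<close>, and then its height at the end is its length.\<close>

lemma adj_acyclic:
  assumes xs: "reduced_path adj xs" "2 \<le> length xs"
  shows "hd xs \<noteq> last xs"
proof
  assume closed: "hd xs = last xs"
  have ne: "xs \<noteq> []" using xs by auto
  have "adj (xs ! 0) (xs ! Suc 0)" using reduced_path_nth[OF xs(1), of 0] xs(2) by simp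
  then have "hd xs \<in> vertices" using adj_vertices ne by (simp add: hd_conv_nth)
  then obtain X where X: "X \<in> carrier E" "hd xs = coset X" by (auto simp: vertices_def)
  have V: "set xs \<subseteq> vertices"
    using reduced_path_subset[OF _ xs(1), of vertices] adj_vertices \<open>hd xs \<in> vertices\<close> by blast
  define ys where "ys = map (act (inv\<^bsub>E\<^esub> X)) xs"
  have inj: "inj_on (act (inv\<^bsub>E\<^esub> X)) (set xs)"
  proof (rule inj_on_inverseI)
    fix u assume "u \<in> set xs"
    then show "act X (act (inv\<^bsub>E\<^esub> X) u) = u"
      using V X act_mult[of X "inv\<^bsub>E\<^esub> X" u] act_one by (auto simp: subset_iff)
  qed
  have ys: "reduced_path adj ys"
    unfolding ys_def by (rule reduced_path_map[OF _ xs(1) inj]) (use X act_adj in auto)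
  have hd: "hd ys = coset \<one>\<^bsub>E\<^esub>" using X ne by (simp add: ys_def hd_map act_coset)
  have "lev (hd ys) = 0" by (simp add: hd lev_coset state_one)
  then have "lev (last ys) = length ys - 1"
    using reduced_path_level[of adj lev ys "length ys - 1"] symp_adj lev_adj parent_unique ys ne
    by (simp add: ys_def last_conv_nth)
  moreover have "last ys = hd ys" using closed ne by (simp add: ys_def hd_map last_map)
  ultimately show False using \<open>lev (hd ys) = 0\<close> xs(2) by (simp add: ys_def)
qed

lemma adj_connected:
  assumes "u \<in> vertices" "v \<in> vertices"
  shows "adj\<^sup>*\<^sup>* u v"
proof -
  have act: "adj\<^sup>*\<^sup>* u v \<Longrightarrow> adj\<^sup>*\<^sup>* (act X u) (act X v)" if "X \<in> carrier E" for X u v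
    by (induction rule: rtranclp_induct) (use act_adj[OF that] in \<open>auto intro: rtranclp.rtrancl_into_rtrancl\<close>)
  have from_base: "adj\<^sup>*\<^sup>* (coset \<one>\<^bsub>E\<^esub>) (coset X)" if "X \<in> carrier E" for X
    using that
  proof (induction rule: hnn_induct)
    case one
    show ?case by simp
  next
    case (base g X)
    then show ?case
      using act[OF base_closed[OF base(1)] base(3)] coset_base[OF E.one_closed base(1)]
      by (simp add: act_coset)
  next
    case (stable s X)
    then have "adj\<^sup>*\<^sup>* (coset (\<tau> s)) (coset (\<tau> s \<otimes>\<^bsub>E\<^esub> X))"
      using act[OF \<tau>_closed stable(2)] by (simp add: act_coset)
    then show ?case using adj_coset[OF E.one_closed, of s] by (simp add: converse_rtranclp_into_rtranclp)
  qed
  have "adj\<^sup>*\<^sup>* u (coset \<one>\<^bsub>E\<^esub>)"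
    using from_base assms(1) sympD[OF symp_rtranclp[OF symp_adj]] by (auto simp: vertices_def)
  also have "adj\<^sup>*\<^sup>* (coset \<one>\<^bsub>E\<^esub>) v" using from_base assms(2) by (auto simp: vertices_def)
  finally show ?thesis .
qed

text \<open>The edge stabilizers: if \<open>t\<^sup>-\<^sup>s h t\<^sup>s\<close> lies in the base group, then its action on the normal form \<open>(1, [])\<close>
  leaves the list empty, so the second stable letter has cancelled the first.\<close>

lemma \<tau>_conj_base:
  assumes h: "h \<in> carrier G" and eq: "coset (base h \<otimes>\<^bsub>E\<^esub> \<tau> s) = coset (\<tau> s)"
  shows "h \<in> assoc (\<not> s)"
proof (rule ccontr)
  assume not: "h \<notin> assoc (\<not> s)"
  obtain g where g: "g \<in> carrier G" "base h \<otimes>\<^bsub>E\<^esub> \<tau> s = \<tau> s \<otimes>\<^bsub>E\<^esub> base g"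
    using coset_eqE[of "\<tau> s" "base h \<otimes>\<^bsub>E\<^esub> \<tau> s"] eq h by auto
  have "eact (base h \<otimes>\<^bsub>E\<^esub> \<tau> s) (\<one>, []) = eact (\<tau> s \<otimes>\<^bsub>E\<^esub> base g) (\<one>, [])" using g by simp
  then have "shift h (step s (\<one>, [])) = step s (shift g (\<one>, []))"
    using h g(1) origin_state by (simp add: eact_mult eact_base eact_\<tau> step_states shift_states)
  then have "step (\<not> s) (shift h (step s (\<one>, []))) = shift g (\<one>, [])"
    using step_step shift_states g(1) origin_state by simp
  moreover have step1: "step s (\<one>, []) = (\<one>, [(s, \<one>)])" by (simp add: step_def pops_def rep_def Let_def)
  moreover have "\<not> pops (\<not> s) (shift h (step s (\<one>, [])))"
    unfolding step1 using not h by (simp add: shift_def pops_def)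
  ultimately show False
    using length_step[of "\<not> s" "shift h (step s (\<one>, []))"] by (simp add: shift_def)
qed

text \<open>An edge in both directions would put \<open>t h t\<close> into the base group, although equal signs never
  cancel.\<close>

lemma arc_asym: "arc u v \<Longrightarrow> \<not> arc v u"
proof
  assume "arc u v" "arc v u"
  then obtain X Y where X: "X \<in> carrier E" "u = coset X" "v = coset (X \<otimes>\<^bsub>E\<^esub> \<tau> True)"
    and Y: "Y \<in> carrier E" "v = coset Y" "u = coset (Y \<otimes>\<^bsub>E\<^esub> \<tau> True)"
    by (auto simp: arc_def)
  obtain h where h: "h \<in> carrier G" "Y = X \<otimes>\<^bsub>E\<^esub> \<tau> True \<otimes>\<^bsub>E\<^esub> base h"
    using coset_eqE[of "X \<otimes>\<^bsub>E\<^esub> \<tau> True" Y] X Y by auto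
  obtain g where g: "g \<in> carrier G" "Y \<otimes>\<^bsub>E\<^esub> \<tau> True = X \<otimes>\<^bsub>E\<^esub> base g"
    using coset_eqE[of X "Y \<otimes>\<^bsub>E\<^esub> \<tau> True"] X Y by auto
  have "X \<otimes>\<^bsub>E\<^esub> (\<tau> True \<otimes>\<^bsub>E\<^esub> (base h \<otimes>\<^bsub>E\<^esub> \<tau> True)) = X \<otimes>\<^bsub>E\<^esub> base g"
    using g h X by (simp add: E.m_assoc)
  then have "\<tau> True \<otimes>\<^bsub>E\<^esub> (base h \<otimes>\<^bsub>E\<^esub> \<tau> True) = base g"
    using X h g by simp
  then have "eact (\<tau> True \<otimes>\<^bsub>E\<^esub> (base h \<otimes>\<^bsub>E\<^esub> \<tau> True)) (\<one>, []) = eact (base g) (\<one>, [])" by simp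
  then have eq: "step True (shift h (step True (\<one>, []))) = shift g (\<one>, [])"
    using h(1) g(1) origin_state by (simp add: eact_mult eact_base eact_\<tau> step_states shift_states)
  have step1: "step True (\<one>, []) = (\<one>, [(True, \<one>)])" by (simp add: step_def pops_def rep_def Let_def)
  have "\<not> pops True (shift h (step True (\<one>, [])))"
    unfolding step1 by (simp add: shift_def pops_def)
  then show False
    using length_step[of True "shift h (step True (\<one>, []))"] unfolding eq by (simp add: shift_def)
qed

lemma fixed_vertexE:
  assumes "X \<in> carrier E" "Y \<in> carrier E" "act X (coset Y) = coset Y"
  obtains h where "h \<in> carrier G" "X \<otimes>\<^bsub>E\<^esub> Y = Y \<otimes>\<^bsub>E\<^esub> base h"
  using coset_eqE[of Y "X \<otimes>\<^bsub>E\<^esub> Y"] assms by (simp add: act_coset) metis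

lemma fixed_edge:
  assumes X: "X \<in> carrier E" and Y: "Y \<in> carrier E" and h: "h \<in> carrier G" "X \<otimes>\<^bsub>E\<^esub> Y = Y \<otimes>\<^bsub>E\<^esub> base h"
    and fixed: "act X (coset (Y \<otimes>\<^bsub>E\<^esub> \<tau> s)) = coset (Y \<otimes>\<^bsub>E\<^esub> \<tau> s)"
  shows "h \<in> assoc (\<not> s)"
proof (rule \<tau>_conj_base[OF h(1)])
  have "X \<otimes>\<^bsub>E\<^esub> (Y \<otimes>\<^bsub>E\<^esub> \<tau> s) = Y \<otimes>\<^bsub>E\<^esub> (base h \<otimes>\<^bsub>E\<^esub> \<tau> s)"
    using X Y h by (metis E.m_assoc \<tau>_closed base_closed)
  then have "act Y (coset (base h \<otimes>\<^bsub>E\<^esub> \<tau> s)) = act Y (coset (\<tau> s))"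
    using fixed X Y h by (simp add: act_coset)
  then have "act (inv\<^bsub>E\<^esub> Y) (act Y (coset (base h \<otimes>\<^bsub>E\<^esub> \<tau> s))) = act (inv\<^bsub>E\<^esub> Y) (act Y (coset (\<tau> s)))"
    by simp
  then show "coset (base h \<otimes>\<^bsub>E\<^esub> \<tau> s) = coset (\<tau> s)"
    using Y h by (simp add: act_coset E.m_assoc[symmetric])
qed

text \<open>Conjugated to the base vertex, \<open>X\<close> becomes an element \<open>h\<close> of \<open>A\<close>, because it fixes the outgoing edge
  to \<open>u\<close>. If the second edge is outgoing too, \<open>h\<close> lies in a conjugate of \<open>A\<close> as well, and malnormality
  of \<open>A\<close> makes the edges equal unless \<open>h = 1\<close>. If it is incoming, \<open>h\<close> lies in a conjugate of \<open>B\<close>, and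
  separation gives \<open>h = 1\<close>. Two incoming edges cannot be excluded, since \<open>B\<close> may fail to be
  malnormal.\<close>

lemma fixed_turn_incoming:
  assumes X: "X \<in> carrier E" and u: "arc v u" and w: "adj v w" and "u \<noteq> w"
    and fixed: "act X u = u" "act X v = v" "act X w = w"
  shows "X = \<one>\<^bsub>E\<^esub>"
proof -
  obtain Y where Y: "Y \<in> carrier E" "v = coset Y" "u = coset (Y \<otimes>\<^bsub>E\<^esub> \<tau> True)"
    using u by (auto simp: arc_def)
  obtain h where h: "h \<in> carrier G" "X \<otimes>\<^bsub>E\<^esub> Y = Y \<otimes>\<^bsub>E\<^esub> base h"
    using fixed_vertexE[OF X Y(1)] fixed(2) Y(2) by metis
  have hA: "h \<in> A" using fixed_edge[OF X Y(1) h, of True] fixed(1) Y(3) by (simp add: assoc_def)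
  obtain Z s where Z: "Z \<in> carrier E" "v = coset Z" "w = coset (Z \<otimes>\<^bsub>E\<^esub> \<tau> s)"
    using adjE[OF w] .
  obtain k where k: "k \<in> carrier G" "Z = Y \<otimes>\<^bsub>E\<^esub> base k"
    using coset_eqE[of Y Z] Y Z by metis
  define h' where "h' = inv k \<otimes> h \<otimes> k"
  have h': "h' \<in> carrier G" "k \<otimes> h' = h \<otimes> k"
    using h k by (simp_all add: h'_def m_assoc) (simp flip: m_assoc)
  have "X \<otimes>\<^bsub>E\<^esub> Z = Y \<otimes>\<^bsub>E\<^esub> base h \<otimes>\<^bsub>E\<^esub> base k" using X Y h(2) k by (simp flip: E.m_assoc)
  also have "\<dots> = Y \<otimes>\<^bsub>E\<^esub> base (k \<otimes> h')"
    unfolding h'(2) using Y(1) h(1) k(1) by (simp add: E.m_assoc base_mult)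
  also have "\<dots> = Z \<otimes>\<^bsub>E\<^esub> base h'"
    using Y(1) h'(1) k by (simp add: E.m_assoc base_mult)
  finally have h's: "h' \<in> assoc (\<not> s)"
    using fixed_edge[OF X Z(1) h'(1)] fixed(3) Z(3) by simp
  have "h = \<one>"
  proof (rule ccontr)
    assume "h \<noteq> \<one>"
    have h_eq: "h = k \<otimes> h' \<otimes> inv k" using h' h k by (simp add: m_assoc)
    then have "h' \<noteq> \<one>" using \<open>h \<noteq> \<one>\<close> k by auto
    show False
    proof (cases s)
      case True
      then have "h' \<in> A" using h's by (simp add: assoc_def)
      then have "k \<in> A" using malnormalD[OF is_group A_malnormal k(1) _ \<open>h' \<noteq> \<one>\<close> hA h'(2)] by simp
      then have kA: "k \<in> assoc (\<not> True)" by (simp add: assoc_def)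
      note \<psi>k = assoc_closed[OF \<psi>_closed[OF kA]]
      have "w = coset (Y \<otimes>\<^bsub>E\<^esub> (base k \<otimes>\<^bsub>E\<^esub> \<tau> True))" using Z True k Y by (simp add: E.m_assoc)
      also have "\<dots> = coset (Y \<otimes>\<^bsub>E\<^esub> \<tau> True \<otimes>\<^bsub>E\<^esub> base (\<psi> (\<not> True) k))"
        unfolding base_\<tau>[OF kA] using Y \<psi>k by (simp add: E.m_assoc)
      also have "\<dots> = u" using Y \<psi>k by (simp add: coset_base)
      finally show False using \<open>u \<noteq> w\<close> by simp
    next
      case False
      then have "h' \<in> B" using h's by (simp add: assoc_def)
      then have "inv (inv k) \<otimes> h' \<otimes> inv k \<in> (inv (inv k) <# B) #> inv k"
        unfolding l_coset_def r_coset_def by blast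
      then have "h \<in> A \<inter> ((inv (inv k) <# B) #> inv k)" using h_eq hA k by simp
      then show False using separated k \<open>h \<noteq> \<one>\<close> unfolding hnn_separated_def by fastforce
    qed
  qed
  then have "X \<otimes>\<^bsub>E\<^esub> Y = Y" using h Y by (simp add: base_one)
  then show ?thesis using X Y by simp
qed

lemma base_inj: "inj_on base (carrier G)"
proof (rule inj_onI)
  fix g h assume gh: "g \<in> carrier G" "h \<in> carrier G" "base g = base h"
  then have "shift g (\<one>, []) = shift h (\<one>, [])" using eact_base origin_state by metis
  then show "g = h" using gh by (simp add: shift_def)
qed

text \<open>The stabilizer of the vertex \<open>Y H\<close> is \<open>Y H Y\<inverse>\<close>.\<close>

lemma stabilizer_laws:
  assumes v: "v \<in> vertices"
  shows "csa_star_laws E {X \<in> carrier E. act X v = v}"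
proof -
  obtain Y where Y: "Y \<in> carrier E" "v = coset Y" using v by (auto simp: vertices_def)
  define f where "f = (\<lambda>g. Y \<otimes>\<^bsub>E\<^esub> base g \<otimes>\<^bsub>E\<^esub> inv\<^bsub>E\<^esub> Y)"
  have "f \<in> hom G E"
  proof (rule homI)
    fix g h assume gh: "g \<in> carrier G" "h \<in> carrier G"
    have "f g \<otimes>\<^bsub>E\<^esub> f h = Y \<otimes>\<^bsub>E\<^esub> base g \<otimes>\<^bsub>E\<^esub> (inv\<^bsub>E\<^esub> Y \<otimes>\<^bsub>E\<^esub> Y) \<otimes>\<^bsub>E\<^esub> base h \<otimes>\<^bsub>E\<^esub> inv\<^bsub>E\<^esub> Y"
      unfolding f_def using gh Y(1) by (simp only: E.m_assoc E.m_closed E.inv_closed base_closed)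
    then show "f (g \<otimes> h) = f g \<otimes>\<^bsub>E\<^esub> f h"
      using gh Y by (simp add: f_def base_mult E.m_assoc)
  qed (use Y in \<open>simp add: f_def\<close>)
  moreover have "inj_on f (carrier G)"
    using base_inj Y by (auto simp: f_def inj_on_def)
  ultimately have "csa_star_laws E (f ` carrier G)"
    using csa_star_laws_image[OF is_group E.is_group _ _ G_laws] by blast
  moreover have "{X \<in> carrier E. act X v = v} = f ` carrier G"
  proof (intro equalityI subsetI)
    fix X assume "X \<in> {X \<in> carrier E. act X v = v}"
    then have X: "X \<in> carrier E" "act X (coset Y) = coset Y" using Y by auto
    obtain h where h: "h \<in> carrier G" "X \<otimes>\<^bsub>E\<^esub> Y = Y \<otimes>\<^bsub>E\<^esub> base h" using fixed_vertexE[OF X(1) Y(1) X(2)] .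
    then have "X = f h" using X Y by (simp add: f_def E.inv_solve_right)
    then show "X \<in> f ` carrier G" using h by blast
  next
    fix X assume "X \<in> f ` carrier G"
    then obtain g where g: "g \<in> carrier G" "X = f g" by blast
    then have "X \<otimes>\<^bsub>E\<^esub> Y = Y \<otimes>\<^bsub>E\<^esub> base g" using Y by (simp add: f_def E.m_assoc)
    then show "X \<in> {X \<in> carrier E. act X v = v}"
      using g Y coset_base by (simp add: f_def act_coset)
  qed
  ultimately show ?thesis by simp
qed

theorem separated_hnn_CSA_star: "CSA_star_group E"
proof -
  interpret tree: tree_action E vertices arc "\<lambda>X u. act X u"
  proof unfold_locales
    show "vertices \<noteq> {}" using coset_in_vertices[OF E.one_closed] by blast
  qed (rule act_vertices act_one act_mult act_arc arc_vertices arc_asym adj_connected adj_acyclic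
      fixed_turn_incoming stabilizer_laws; assumption)+
  show ?thesis using laws_imp_CSA_star_group[OF E.is_group tree.tree_action_laws] .
qed

end

section \<open>Separated HNN-extensions of CSA-groups\<close>

theorem theorem4:
  fixes G :: "('a, 'b) monoid_scheme"
    and A B :: "'a set"
    and \<phi> :: "'a \<Rightarrow> 'a"
  assumes "CSA_star_group G"
    and "comm_subgroup A G" and "comm_subgroup B G"
    and "\<phi> \<in> iso (G\<lparr>carrier := A\<rparr>) (G\<lparr>carrier := B\<rparr>)"
    and "maximal_comm_subgroup A G"
    and "hnn_separated G A B"
  shows "CSA_star_group (hnn_extension G A \<phi>)"
proof -
  have G: "group G" and mal: "malnormal A G"
    using assms(1,5) by (simp_all add: CSA_star_group_def CSA_group_def)
  have A: "subgroup A G" and B: "subgroup B G"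
    using assms(2,3) by (simp_all add: comm_subgroup_def)
  have "\<phi> a \<in> B" if "a \<in> A" for a
    using assms(4) that by (auto simp: iso_def hom_def)
  then have "hnn_data G A \<phi>"
    using G subgroup.subset[OF A] subgroup.subset[OF B]
    by (auto simp: hnn_data_def hnn_data_axioms_def)
  then interpret separated_hnn G A \<phi> B
    using A B assms(4,6) mal CSA_star_group_imp_laws[OF assms(1)]
    by (simp add: separated_hnn_def separated_hnn_axioms_def hnn_iso_def hnn_iso_axioms_def)
  show ?thesis by (rule separated_hnn_CSA_star)
qed

end
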